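(* Let $\omega=2$. The constant $\mathbf M^{\mathrm{crt}}_{t,p}$ is finite for every $p>0$ and $t>0$. Moreover: (1) if $p<\frac{2\kappa}{t\mathcal G}$ (equivalently $t<\frac{2\kappa}{p\mathcal G}$), then $\mathbf M^{\mathrm{crt}}_{t,p}=0$; and (2) if $p>\frac{2\kappa}{t\mathcal G}$ (equivalently $t>\frac{2\kappa}{p\mathcal G}$), then $\mathbf M^{\mathrm{crt}}_{t,p}$ is positive and strictly increasing in $p$.
   Context: Fix $d\in\mathbb N$, $\kappa>0$, $\sigma>0$. The kernel $\gamma$ on $\mathbb R^d$ is one of: (White) $\gamma=\sigma^2\delta_0$, with $\omega:=d$; (Riesz) $\gamma(x)=\sigma^2|x|^{-\omega}$ with $0<\omega<d$; (Fractional) $\gamma(x)=\sigma^2\prod_{i=1}^d|x_i|^{-\omega_i}$ with $\omega_i\in(0,1)$ and $\omega:=\sum_{i=1}^d\omega_i$. Here the scaling exponent is $\omega=2$. For white noise, $\iint f(x)^2\gamma(x-y)f(y)^2\,dx\,dy$ means $\sigma^2\int f(x)^4\,dx$. Let $\gamma_1=\gamma*p_1$ with $p_1(x)=(2\pi)^{-d/2}e^{-|x|^2/2}$. Define $$\mathbf M^{\mathrm{crt}}_{t,p}=\sup_{f\in H^1(\mathbb R^d),\,\|f\|_2=1}\Big(\frac{pt}2\iint f(x)^2\gamma_1(x-y)f(y)^2\,dx\,dy-\kappa\int|\nabla f(x)|^2dx\Big),$$ $$\mathcal G=\inf\Big\{C>0:\iint f(x)^2\gamma(x-y)f(y)^2\,dx\,dy\le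 C\int|\nabla f(x)|^2dx\ \ \forall f\in H^1(\mathbb R^d)\text{ with }\|f\|_2=1\Big\},$$ and $\mathcal G$ is finite when $\omega=2$. *)

theory Defs
  imports "HOL-Analysis.Analysis"
begin

section \<open>The space \<open>H\<^sup>1\<close>\<close>

definition L2_space :: "('a::euclidean_space \<Rightarrow> 'b::euclidean_space) set" where
  "L2_space = {f. f \<in> borel_measurable lborel \<and> integrable lborel (\<lambda>x. (norm (f x))\<^sup>2)}"

definition l2_norm :: "('a::euclidean_space \<Rightarrow> 'b::euclidean_space) \<Rightarrow> real" where
  "l2_norm f = sqrt (\<integral>x. (norm (f x))\<^sup>2 \<partial>lborel)"

definition partial_deriv :: "'n \<Rightarrow> (real^'n \<Rightarrow> real) \<Rightarrow> real^'n \<Rightarrow> real" where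
  "partial_deriv i f x = frechet_derivative f (at x) (axis i 1)"

fun k_times_cont_diff :: "nat \<Rightarrow> (real^'n \<Rightarrow> real) \<Rightarrow> bool" where
  "k_times_cont_diff 0 f \<longleftrightarrow> continuous_on UNIV f"
| "k_times_cont_diff (Suc k) f \<longleftrightarrow>
     (\<forall>x. f differentiable (at x)) \<and> (\<forall>i. k_times_cont_diff k (partial_deriv i f))"

definition test_function :: "(real^'n \<Rightarrow> real) \<Rightarrow> bool" where
  "test_function \<phi> \<longleftrightarrow>
     (\<forall>k. k_times_cont_diff k \<phi>) \<and> compact (closure {x. \<phi> x \<noteq> 0})"

definition has_weak_gradient ::
    "(real^'n \<Rightarrow> real) \<Rightarrow> (real^'n \<Rightarrow> real^'n) \<Rightarrow> bool" where
  "has_weak_gradient f Df \<longleftrightarrow>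
     (\<forall>\<phi> i. test_function \<phi> \<longrightarrow>
        (\<integral>x. f x * partial_deriv i \<phi> x \<partial>lborel) = - (\<integral>x. Df x $ i * \<phi> x \<partial>lborel))"

text \<open>
  The pairs \<open>(f, \<nabla>f)\<close> with \<open>f \<in> H\<^sup>1\<close>, \<open>\<parallel>f\<parallel>\<^sub>2 = 1\<close>.  The second component ranges over all
  representatives of the weak gradient; these agree almost everywhere, so an integral of a
  representative depends on \<open>f\<close> only.
\<close>
definition H1_unit :: "((real^'n \<Rightarrow> real) \<times> (real^'n \<Rightarrow> real^'n)) set" where
  "H1_unit = {(f, Df). f \<in> L2_space \<and> Df \<in> L2_space \<and> has_weak_gradient f Df \<and> l2_norm f = 1}"


section \<open>The noises\<close>

datatype 'n noise = White | Riesz real | Fractional "'n \<Rightarrow> real"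

fun admissible :: "'n::finite noise \<Rightarrow> bool" where
  "admissible White \<longleftrightarrow> True"
| "admissible (Riesz w) \<longleftrightarrow> 0 < w \<and> w < real CARD('n)"
| "admissible (Fractional w) \<longleftrightarrow> (\<forall>i. 0 < w i \<and> w i < 1)"

fun scaling_exponent :: "'n::finite noise \<Rightarrow> real" where
  "scaling_exponent White = real CARD('n)"
| "scaling_exponent (Riesz w) = w"
| "scaling_exponent (Fractional w) = (\<Sum>i\<in>UNIV. w i)"

text \<open>
  On the Lebesgue null set where the kernels are singular, the convention \<open>0 powr a = 0\<close>
  makes them vanish; no integral below sees this.
\<close>
definition riesz_kernel :: "real \<Rightarrow> real \<Rightarrow> real^'n \<Rightarrow> ennreal" where
  "riesz_kernel \<sigma> w x = ennreal (\<sigma>\<^sup>2 * norm x powr (- w))"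

definition fractional_kernel :: "real \<Rightarrow> ('n \<Rightarrow> real) \<Rightarrow> real^'n \<Rightarrow> ennreal" where
  "fractional_kernel \<sigma> w x = ennreal (\<sigma>\<^sup>2 * (\<Prod>i\<in>UNIV. \<bar>x $ i\<bar> powr (- w i)))"

definition gauss :: "real^'n \<Rightarrow> real" where
  "gauss x = (2 * pi) powr (- real CARD('n) / 2) * exp (- (norm x)\<^sup>2 / 2)"

definition gauss_convolution :: "(real^'n \<Rightarrow> ennreal) \<Rightarrow> real^'n \<Rightarrow> ennreal" where
  "gauss_convolution k x = (\<integral>\<^sup>+y. k (x - y) * ennreal (gauss y) \<partial>lborel)"

text \<open>\<open>\<gamma>\<^sub>1 = \<gamma> * p\<^sub>1\<close>, where \<open>\<delta>\<^sub>0 * p\<^sub>1 = p\<^sub>1\<close>.\<close>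
fun smoothed_kernel :: "real \<Rightarrow> 'n::finite noise \<Rightarrow> real^'n \<Rightarrow> ennreal" where
  "smoothed_kernel \<sigma> White = (\<lambda>x. ennreal (\<sigma>\<^sup>2 * gauss x))"
| "smoothed_kernel \<sigma> (Riesz w) = gauss_convolution (riesz_kernel \<sigma> w)"
| "smoothed_kernel \<sigma> (Fractional w) = gauss_convolution (fractional_kernel \<sigma> w)"


section \<open>Energies and the two constants\<close>

definition pair_energy :: "(real^'n \<Rightarrow> ennreal) \<Rightarrow> (real^'n \<Rightarrow> real) \<Rightarrow> ennreal" where
  "pair_energy k f =
     (\<integral>\<^sup>+x. (\<integral>\<^sup>+y. ennreal ((f x)\<^sup>2) * k (x - y) * ennreal ((f y)\<^sup>2) \<partial>lborel) \<partial>lborel)"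

text \<open>The double integral of \<open>f(x)\<^sup>2 \<gamma>(x - y) f(y)\<^sup>2\<close>; for white noise it is \<open>\<sigma>\<^sup>2 \<integral> f\<^sup>4\<close>.\<close>
fun noise_energy :: "real \<Rightarrow> 'n::finite noise \<Rightarrow> (real^'n \<Rightarrow> real) \<Rightarrow> ennreal" where
  "noise_energy \<sigma> White f = ennreal (\<sigma>\<^sup>2) * (\<integral>\<^sup>+x. ennreal ((f x) ^ 4) \<partial>lborel)"
| "noise_energy \<sigma> (Riesz w) f = pair_energy (riesz_kernel \<sigma> w) f"
| "noise_energy \<sigma> (Fractional w) f = pair_energy (fractional_kernel \<sigma> w) f"

definition gradient_energy :: "(real^'n \<Rightarrow> real^'n) \<Rightarrow> real" where
  "gradient_energy Df = (\<integral>x. (norm (Df x))\<^sup>2 \<partial>lborel)"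

definition M_crt :: "real \<Rightarrow> real \<Rightarrow> 'n::finite noise \<Rightarrow> real \<Rightarrow> real \<Rightarrow> ereal" where
  "M_crt \<kappa> \<sigma> \<gamma> t p =
     (SUP (f, Df) \<in> (H1_unit :: ((real^'n \<Rightarrow> real) \<times> _) set).
        ereal (p * t / 2) * enn2ereal (pair_energy (smoothed_kernel \<sigma> \<gamma>) f)
        - ereal (\<kappa> * gradient_energy Df))"

text \<open>The infimum is taken in the extended reals, so it is \<open>\<infinity>\<close> if no constant exists.\<close>
definition G_const :: "real \<Rightarrow> 'n::finite noise \<Rightarrow> ereal" where
  "G_const \<sigma> \<gamma> =
     Inf (ereal ` {C. 0 < C \<and>
       (\<forall>(f, Df) \<in> (H1_unit :: ((real^'n \<Rightarrow> real) \<times> _) set).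
          noise_energy \<sigma> \<gamma> f \<le> ennreal (C * gradient_energy Df))})"

end

theory Submission
  imports Defs "HOL-Probability.Distributions"
begin

text \<open>
  Write \<open>E\<close> for the energy of \<open>f\<^sup>2\<close> with respect to \<open>\<gamma>\<close>, \<open>E\<^sub>1\<close> for the energy with respect to
  \<open>\<gamma>\<^sub>1 = \<gamma> * p\<^sub>1\<close>, and \<open>D\<close> for the gradient energy.  Everything follows from three properties of
  \<open>\<gamma>\<^sub>1\<close> and from the dilations \<open>f\<^sub>c(x) = c powr (d/2) f(c x)\<close>, which preserve the \<open>L\<^sup>2\<close> norm and
  multiply \<open>D\<close> by \<open>c\<^sup>2\<close>.

  Boundedness (\<open>smoothed_kernel_bounded\<close>).  The power singularities of \<open>\<gamma>\<close> are integrable, so \<open>\<gamma>\<^sub>1\<close>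
  is bounded and \<open>E\<^sub>1\<close> is bounded on the unit sphere.  This gives finiteness.  The supremum is at
  least \<open>0\<close> because dilating with \<open>c \<rightarrow> 0\<close> sends \<open>D\<close> to \<open>0\<close>.

  Smoothing decreases energy (\<open>smoothed_energy_le_noise_energy\<close>), that is \<open>E\<^sub>1 \<le> E\<close>.  The energy for
  \<open>\<gamma> * p\<^sub>1\<close> is an average of energies for translates of \<open>\<gamma>\<close>, and for a positive definite kernel no
  translate has larger energy than the kernel itself.  Gaussians have this property because they
  are self-convolutions, and the Riesz and fractional kernels inherit it because they are
  superpositions of Gaussians by Euler's integral for the Gamma function; for white noise the
  inequality between arithmetic and geometric means applies directly.  For \<open>p\<close> below the
  threshold it follows that \<open>p t E\<^sub>1 / 2 \<le> \<kappa> D\<close>, and the supremum is \<open>0\<close>.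

  Consistency (\<open>noise_energy_le_liminf\<close>).  As \<open>\<gamma>\<close> is homogeneous of degree \<open>- 2\<close>,
  \<open>E\<^sub>1(f\<^sub>c) / c\<^sup>2\<close> is the energy of \<open>f\<close> for \<open>\<gamma>\<close> smoothed at scale \<open>c\<close>, and its limit inferior for
  \<open>c \<rightarrow> 0\<close> is at least \<open>E(f)\<close> by Fatou's lemma, applied to the kernel itself or, for white noise,
  to the autocorrelation of \<open>f\<^sup>2\<close>.  For \<open>p\<close> above the threshold some \<open>f\<close> has
  \<open>p t E(f) / 2 > \<kappa> D(f)\<close>.  Both terms scale like \<open>c\<^sup>2\<close> under dilation, which is the critical nature
  of the exponent \<open>2\<close>, so the inequality persists for \<open>E\<^sub>1\<close> and \<open>f\<^sub>c\<close> with \<open>c\<close> small, and the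
  supremum is positive.  It is strictly increasing there because its quotient by \<open>p\<close> is
  nondecreasing.
\<close>

section \<open>Changes of variables and Gaussian integrals\<close>

lemma nn_integral_lborel_affine:
  fixes f :: "'a::euclidean_space \<Rightarrow> ennreal"
  assumes [measurable]: "f \<in> borel_measurable borel" and c: "c \<noteq> 0"
  shows "(\<integral>\<^sup>+x. f x \<partial>lborel) = ennreal (\<bar>c\<bar> ^ DIM('a)) * (\<integral>\<^sup>+x. f (t + c *\<^sub>R x) \<partial>lborel)"
  by (subst lborel_affine[OF c, of t])
     (simp add: nn_integral_density nn_integral_distr nn_integral_cmult del: ennreal_power)

lemma nn_integral_lborel_translate:
  fixes f :: "'a::euclidean_space \<Rightarrow> ennreal"
  assumes [measurable]: "f \<in> borel_measurable borel"
  shows "(\<integral>\<^sup>+x. f (x - t) \<partial>lborel) = (\<integral>\<^sup>+x. f x \<partial>lborel)"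
  using nn_integral_lborel_affine[of f 1 "- t"] assms by simp

lemma nn_integral_lborel_reflect:
  fixes f :: "'a::euclidean_space \<Rightarrow> ennreal"
  assumes [measurable]: "f \<in> borel_measurable borel"
  shows "(\<integral>\<^sup>+x. f (t - x) \<partial>lborel) = (\<integral>\<^sup>+x. f x \<partial>lborel)"
  using nn_integral_lborel_affine[of f "-1" "t"] assms by simp

lemma lborel_integral_scale:
  fixes f :: "'a::euclidean_space \<Rightarrow> real"
  assumes [measurable]: "f \<in> borel_measurable borel" and c: "c > 0"
  shows "(\<integral>x. f (c *\<^sub>R x) \<partial>lborel) = (\<integral>x. f x \<partial>lborel) / c ^ DIM('a)"
proof -
  have "(\<integral>x. f x \<partial>lborel) = c ^ DIM('a) * (\<integral>x. f (c *\<^sub>R x) \<partial>lborel)"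
    using c by (subst lborel_affine[of c 0])
      (simp_all add: integral_density integral_distr del: ennreal_power)
  then show ?thesis using c by simp
qed

lemma lborel_integrable_scale:
  fixes f :: "'a::euclidean_space \<Rightarrow> real"
  assumes f: "integrable lborel f" and c: "c > 0"
  shows "integrable lborel (\<lambda>x. f (c *\<^sub>R x))"
proof -
  have [measurable]: "f \<in> borel_measurable borel" using f by auto
  have "integrable (density (distr lborel borel (\<lambda>x. 0 + c *\<^sub>R x)) (\<lambda>_. \<bar>c\<bar> ^ DIM('a))) f"
    using f lborel_affine[of c "0::'a"] c by simp
  then show ?thesis
    using c by (simp add: integrable_density integrable_distr_eq del: ennreal_power)
qed

text \<open>
  Integrals of products over the coordinates factorise.  This turns every Gaussian and every
  fractional integral below into one-dimensional ones.
\<close>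
lemma nn_integral_vec_prod:
  fixes h :: "'n::finite \<Rightarrow> real \<Rightarrow> ennreal"
  assumes [measurable]: "\<And>i. h i \<in> borel_measurable borel"
  shows "(\<integral>\<^sup>+x. (\<Prod>i\<in>UNIV. h i (x $ i)) \<partial>(lborel :: (real^'n) measure)) = (\<Prod>i\<in>UNIV. \<integral>\<^sup>+t. h i t \<partial>lborel)"
proof -
  let ?e = "\<lambda>i::'n. axis i (1::real)"
  have inj_e: "inj ?e" by (auto simp: inj_def axis_eq_axis)
  have B: "Basis = range ?e" by (auto simp: Basis_vec_def)
  have *: "(\<Prod>b\<in>Basis. F (inv ?e b) b) = (\<Prod>i\<in>UNIV. F i (?e i))" for F :: "'n \<Rightarrow> real^'n \<Rightarrow> ennreal"
    unfolding B using inj_e by (subst prod.reindex) (auto simp: inv_f_f[OF inj_e])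
  show ?thesis
    using nn_integral_lborel_prod[of "\<lambda>b. h (inv ?e b)"]
    by (simp add: *[of "\<lambda>i b. h i (_ \<bullet> b)"] *[of "\<lambda>i b. integral\<^sup>N lborel (h i)"] cart_eq_inner_axis)
qed

lemma nn_integral_exp_square:
  assumes "a > (0::real)"
  shows "(\<integral>\<^sup>+t. ennreal (exp (- (a * t\<^sup>2))) \<partial>lborel) = ennreal (sqrt (pi / a))"
proof -
  define s where "s = sqrt (1 / (2 * a))"
  have s: "s > 0" "s\<^sup>2 = 1 / (2 * a)" using assms by (auto simp: s_def)
  have "(\<integral>\<^sup>+t. ennreal (exp (- (a * t\<^sup>2))) \<partial>lborel)
      = (\<integral>\<^sup>+t. ennreal (sqrt (pi / a)) * ennreal (normal_density 0 s t) \<partial>lborel)"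
    using assms by (intro nn_integral_cong)
      (simp add: normal_density_def s ennreal_mult[symmetric] real_sqrt_divide field_simps)
  also have "\<dots> = ennreal (sqrt (pi / a)) * 1"
    using integral_normal_density[OF s(1), of 0] s
    by (subst nn_integral_cmult) (auto simp: nn_integral_eq_integral)
  finally show ?thesis by simp
qed

lemma gauss_prod: "gauss (x :: real^'n::finite) = (\<Prod>i\<in>UNIV. std_normal_density (x $ i))"
proof -
  have "(2 * pi) powr (- real CARD('n) / 2) = (1 / sqrt (2 * pi)) ^ CARD('n)"
    by (simp add: powr_half_sqrt[symmetric] powr_minus_divide[symmetric] powr_realpow[symmetric] powr_powr)
  moreover have "exp (- (norm x)\<^sup>2 / 2) = (\<Prod>i\<in>UNIV. exp (- (x $ i)\<^sup>2 / 2))"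
    by (simp add: norm_vec_def L2_set_def exp_sum[symmetric] sum_nonneg sum_negf sum_divide_distrib)
  ultimately show ?thesis
    by (simp add: gauss_def std_normal_density_def prod_dividef prod_constant power_divide)
qed

lemma gauss_nonneg [simp]: "0 \<le> gauss x"
  by (simp add: gauss_def)

lemma borel_measurable_gauss [measurable]: "gauss \<in> borel_measurable borel"
  unfolding gauss_def by measurable

lemma nn_integral_gauss: "(\<integral>\<^sup>+x. ennreal (gauss x) \<partial>(lborel :: (real^'n::finite) measure)) = 1"
proof -
  have "(\<integral>\<^sup>+t. ennreal (std_normal_density t) \<partial>lborel) = 1"
    using integral_normal_density[of 1 0] by (subst nn_integral_eq_integral) auto
  then show ?thesis
    using nn_integral_vec_prod[of "\<lambda>i::'n. \<lambda>t. ennreal (std_normal_density t)"]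
    by (simp add: gauss_prod prod_ennreal)
qed

definition gaussian :: "('n \<Rightarrow> real) \<Rightarrow> real^'n::finite \<Rightarrow> real" where
  "gaussian a x = exp (- (\<Sum>i\<in>UNIV. a i * (x $ i)\<^sup>2))"

lemma gaussian_pos [simp]: "0 < gaussian a x" "0 \<le> gaussian a x"
  by (auto simp: gaussian_def)

lemma borel_measurable_gaussian [measurable]: "gaussian a \<in> borel_measurable borel"
  unfolding gaussian_def by measurable

lemma gaussian_minus [simp]: "gaussian a (- x) = gaussian a x"
  by (simp add: gaussian_def)

lemma nn_integral_gaussian:
  assumes "\<And>i. a i > 0"
  shows "(\<integral>\<^sup>+x. ennreal (gaussian a x) \<partial>lborel) = ennreal (\<Prod>i\<in>UNIV. sqrt (pi / a i))"
proof -
  have "ennreal (gaussian a x) = (\<Prod>i\<in>UNIV. ennreal (exp (- (a i * (x $ i)\<^sup>2))))" for x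
    by (simp add: gaussian_def prod_ennreal exp_sum[symmetric] sum_negf)
  then show ?thesis
    using assms nn_integral_vec_prod[of "\<lambda>i t. ennreal (exp (- (a i * t\<^sup>2)))"]
    by (simp add: nn_integral_exp_square prod_ennreal less_imp_le)
qed

text \<open>
  Parallelogram identity in each coordinate: with the midpoint \<open>m\<close> of \<open>x\<close> and \<open>y\<close>,
  \<open>2 (x - u)\<^sup>2 + 2 (u - y)\<^sup>2 = (x - y)\<^sup>2 + 4 (m - u)\<^sup>2\<close>.
\<close>
lemma gaussian_mult_gaussian:
  "gaussian (\<lambda>i. 2 * a i) (x - u) * gaussian (\<lambda>i. 2 * a i) (u - y)
    = gaussian a (x - y) * gaussian (\<lambda>i. 4 * a i) ((1/2) *\<^sub>R (x + y) - u)"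
proof -
  have "2 * a i * ((x - u) $ i)\<^sup>2 + 2 * a i * ((u - y) $ i)\<^sup>2
      = a i * ((x - y) $ i)\<^sup>2 + 4 * a i * (((1/2) *\<^sub>R (x + y) - u) $ i)\<^sup>2" for i
    by (simp add: power2_eq_square field_simps)
  then have "(\<Sum>i\<in>UNIV. 2 * a i * ((x - u) $ i)\<^sup>2) + (\<Sum>i\<in>UNIV. 2 * a i * ((u - y) $ i)\<^sup>2)
      = (\<Sum>i\<in>UNIV. a i * ((x - y) $ i)\<^sup>2) + (\<Sum>i\<in>UNIV. 4 * a i * (((1/2) *\<^sub>R (x + y) - u) $ i)\<^sup>2)"
    by (simp only: sum.distrib[symmetric])
  then show ?thesis
    unfolding gaussian_def exp_add[symmetric] by simp
qed

text \<open>
  A Gaussian is a multiple of the self-convolution of a narrower Gaussian.  This square root is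
  what makes Gaussian kernels positive definite.
\<close>
lemma gaussian_conv_gaussian:
  assumes "\<And>i. a i > 0"
  shows "(\<integral>\<^sup>+u. ennreal (gaussian (\<lambda>i. 2 * a i) (x - u)) * ennreal (gaussian (\<lambda>i. 2 * a i) (u - y)) \<partial>lborel)
    = ennreal (\<Prod>i\<in>UNIV. sqrt (pi / (4 * a i))) * ennreal (gaussian a (x - y))"
proof -
  have "(\<integral>\<^sup>+u. ennreal (gaussian (\<lambda>i. 2 * a i) (x - u)) * ennreal (gaussian (\<lambda>i. 2 * a i) (u - y)) \<partial>lborel)
     = (\<integral>\<^sup>+u. ennreal (gaussian a (x - y)) * ennreal (gaussian (\<lambda>i. 4 * a i) ((1/2) *\<^sub>R (x + y) - u)) \<partial>lborel)"
    by (intro nn_integral_cong) (simp add: ennreal_mult[symmetric] gaussian_mult_gaussian)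
  also have "\<dots> = ennreal (gaussian a (x - y)) * (\<integral>\<^sup>+u. ennreal (gaussian (\<lambda>i. 4 * a i) u) \<partial>lborel)"
    by (subst nn_integral_cmult)
       (simp_all add: nn_integral_lborel_reflect[of "\<lambda>u. ennreal (gaussian (\<lambda>i. 4 * a i) u)"])
  finally show ?thesis
    using assms by (simp add: nn_integral_gaussian mult.commute)
qed

section \<open>Kernels whose energy does not increase under translation\<close>

text \<open>
  \<open>2 g(x) g(x - z) \<le> g(x)\<^sup>2 + g(x - z)\<^sup>2\<close>, and both squares have the same integral.  Unlike
  Cauchy--Schwarz this needs no case distinction on whether the integrals are finite.
\<close>
lemma nn_integral_autocorrelation_le:
  fixes g :: "'a::euclidean_space \<Rightarrow> ennreal"
  assumes [measurable]: "g \<in> borel_measurable borel"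
  shows "(\<integral>\<^sup>+x. g x * g (x - z) \<partial>lborel) \<le> (\<integral>\<^sup>+x. g x * g x \<partial>lborel)"
proof -
  have amgm: "2 * (a * b) \<le> a * a + b * b" for a b :: ennreal
  proof (cases "a = top \<or> b = top")
    case True
    then show ?thesis by (auto simp: ennreal_top_mult)
  next
    case False
    then obtain r s where "a = ennreal r" "b = ennreal s" "r \<ge> 0" "s \<ge> 0"
      by (cases a; cases b) auto
    moreover have "2 * (r * s) \<le> r * r + s * s"
      using sum_squares_bound[of r s] by (simp add: power2_eq_square)
    ultimately show ?thesis
      by (simp add: ennreal_mult[symmetric] ennreal_plus[symmetric] ennreal_numeral[symmetric]
          del: ennreal_plus ennreal_numeral)
  qed
  have "2 * (\<integral>\<^sup>+x. g x * g (x - z) \<partial>lborel) = (\<integral>\<^sup>+x. 2 * (g x * g (x - z)) \<partial>lborel)"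
    by (simp add: nn_integral_cmult)
  also have "\<dots> \<le> (\<integral>\<^sup>+x. g x * g x + g (x - z) * g (x - z) \<partial>lborel)"
    by (intro nn_integral_mono amgm)
  also have "\<dots> = (\<integral>\<^sup>+x. g x * g x \<partial>lborel) + (\<integral>\<^sup>+x. g (x - z) * g (x - z) \<partial>lborel)"
    by (simp add: nn_integral_add)
  also have "\<dots> = 2 * (\<integral>\<^sup>+x. g x * g x \<partial>lborel)"
    using nn_integral_lborel_translate[of "\<lambda>x. g x * g x" z] by (simp add: mult_2)
  finally show ?thesis
    by (subst (asm) ennreal_mult_le_mult_iff) auto
qed

text \<open>
  Substitute \<open>y = x - z\<close>: a convolution kernel acts on a pair energy only through the
  autocorrelation of the density.
\<close>
lemma nn_integral_pair_correlation:
  fixes g h :: "'a::euclidean_space \<Rightarrow> ennreal"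
  assumes [measurable]: "g \<in> borel_measurable borel" "h \<in> borel_measurable borel"
  shows "(\<integral>\<^sup>+x. (\<integral>\<^sup>+y. g x * h (x - y) * g y \<partial>lborel) \<partial>lborel)
    = (\<integral>\<^sup>+z. h z * (\<integral>\<^sup>+x. g x * g (x - z) \<partial>lborel) \<partial>lborel)"
proof -
  have "(\<integral>\<^sup>+x. (\<integral>\<^sup>+y. g x * h (x - y) * g y \<partial>lborel) \<partial>lborel)
    = (\<integral>\<^sup>+x. (\<integral>\<^sup>+z. h z * (g x * g (x - z)) \<partial>lborel) \<partial>lborel)"
  proof (rule nn_integral_cong)
    fix x :: 'a
    show "(\<integral>\<^sup>+y. g x * h (x - y) * g y \<partial>lborel) = (\<integral>\<^sup>+z. h z * (g x * g (x - z)) \<partial>lborel)"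
      using nn_integral_lborel_reflect[of "\<lambda>z. h z * (g x * g (x - z))" x]
      by (simp add: mult_ac)
  qed
  also have "\<dots> = (\<integral>\<^sup>+z. (\<integral>\<^sup>+x. h z * (g x * g (x - z)) \<partial>lborel) \<partial>lborel)"
    by (rule lborel_pair.Fubini') measurable
  also have "\<dots> = (\<integral>\<^sup>+z. h z * (\<integral>\<^sup>+x. g x * g (x - z) \<partial>lborel) \<partial>lborel)"
    by (simp add: nn_integral_cmult)
  finally show ?thesis .
qed

text \<open>
  The consequence of positive definiteness that the proof uses: translating the kernel cannot
  increase the energy of any nonnegative density.  Unlike positive definiteness itself, it involves
  nonnegative functions only, so it passes to superpositions of kernels by Tonelli's theorem alone,
  whatever is infinite.
\<close>
definition shift_dominated :: "(real^'n::finite \<Rightarrow> ennreal) \<Rightarrow> bool" where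
  "shift_dominated k \<longleftrightarrow> k \<in> borel_measurable borel \<and>
    (\<forall>g z. g \<in> borel_measurable borel \<longrightarrow>
      (\<integral>\<^sup>+x. (\<integral>\<^sup>+y. g x * k (x - y - z) * g y \<partial>lborel) \<partial>lborel)
        \<le> (\<integral>\<^sup>+x. (\<integral>\<^sup>+y. g x * k (x - y) * g y \<partial>lborel) \<partial>lborel))"

lemma shift_dominatedD:
  assumes "shift_dominated k" "g \<in> borel_measurable borel"
  shows "(\<integral>\<^sup>+x. (\<integral>\<^sup>+y. g x * k (x - y - z) * g y \<partial>lborel) \<partial>lborel)
        \<le> (\<integral>\<^sup>+x. (\<integral>\<^sup>+y. g x * k (x - y) * g y \<partial>lborel) \<partial>lborel)"
  using assms by (auto simp: shift_dominated_def)

text \<open>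
  If \<open>k = A * A\<close> with \<open>A\<close> even, then with \<open>H = g * A\<close> the energy of \<open>g\<close> for the kernel translated
  by \<open>z\<close> is the autocorrelation \<open>\<integral> H(u) H(u - z) du\<close>, which is largest at \<open>z = 0\<close>.
\<close>
lemma shift_dominated_autoconvolution:
  fixes A k :: "real^'n::finite \<Rightarrow> ennreal"
  assumes [measurable]: "A \<in> borel_measurable borel" "k \<in> borel_measurable borel"
    and even: "\<And>x. A (- x) = A x"
    and conv: "\<And>x y. (\<integral>\<^sup>+u. A (x - u) * A (u - y) \<partial>lborel) = k (x - y)"
  shows "shift_dominated k"
  unfolding shift_dominated_def
proof (intro conjI allI impI)
  fix g :: "real^'n \<Rightarrow> ennreal" and z
  assume [measurable]: "g \<in> borel_measurable borel"
  define H where "H u = (\<integral>\<^sup>+x. g x * A (x - u) \<partial>lborel)" for u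
  have [measurable]: "H \<in> borel_measurable borel" unfolding H_def by measurable
  have *: "(\<integral>\<^sup>+x. (\<integral>\<^sup>+y. g x * k (x - y - z) * g y \<partial>lborel) \<partial>lborel) = (\<integral>\<^sup>+u. H u * H (u - z) \<partial>lborel)" for z
  proof -
    have "(\<integral>\<^sup>+y. g x * k (x - y - z) * g y \<partial>lborel) = (\<integral>\<^sup>+u. g x * A (x - u) * H (u - z) \<partial>lborel)" for x
    proof -
      have "(\<integral>\<^sup>+y. g x * k (x - y - z) * g y \<partial>lborel)
        = (\<integral>\<^sup>+y. (\<integral>\<^sup>+u. (g x * A (x - u)) * (g y * A (y - (u - z))) \<partial>lborel) \<partial>lborel)"
      proof (intro nn_integral_cong)
        fix y
        have "k (x - y - z) = (\<integral>\<^sup>+u. A (x - u) * A (u - (y + z)) \<partial>lborel)"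
          by (simp add: conv diff_diff_eq)
        also have "\<dots> = (\<integral>\<^sup>+u. A (x - u) * A (y - (u - z)) \<partial>lborel)"
          using even[of "_ - (y + z)"] by (simp add: algebra_simps)
        finally have k: "k (x - y - z) = (\<integral>\<^sup>+u. A (x - u) * A (y - (u - z)) \<partial>lborel)" .
        have "g x * k (x - y - z) * g y
            = (g x * g y) * (\<integral>\<^sup>+u. A (x - u) * A (y - (u - z)) \<partial>lborel)"
          unfolding k by (simp add: mult_ac)
        also have "\<dots> = (\<integral>\<^sup>+u. (g x * g y) * (A (x - u) * A (y - (u - z))) \<partial>lborel)"
          by (rule nn_integral_cmult[symmetric]) measurable
        also have "\<dots> = (\<integral>\<^sup>+u. (g x * A (x - u)) * (g y * A (y - (u - z))) \<partial>lborel)"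
          by (simp add: mult_ac)
        finally show "g x * k (x - y - z) * g y = (\<integral>\<^sup>+u. (g x * A (x - u)) * (g y * A (y - (u - z))) \<partial>lborel)" .
      qed
      also have "\<dots> = (\<integral>\<^sup>+u. (\<integral>\<^sup>+y. (g x * A (x - u)) * (g y * A (y - (u - z))) \<partial>lborel) \<partial>lborel)"
        by (rule lborel_pair.Fubini') measurable
      also have "\<dots> = (\<integral>\<^sup>+u. g x * A (x - u) * H (u - z) \<partial>lborel)"
        unfolding H_def by (intro nn_integral_cong nn_integral_cmult) measurable
      finally show ?thesis .
    qed
    then have "(\<integral>\<^sup>+x. (\<integral>\<^sup>+y. g x * k (x - y - z) * g y \<partial>lborel) \<partial>lborel)
      = (\<integral>\<^sup>+x. (\<integral>\<^sup>+u. g x * A (x - u) * H (u - z) \<partial>lborel) \<partial>lborel)" by simp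
    also have "\<dots> = (\<integral>\<^sup>+u. (\<integral>\<^sup>+x. g x * A (x - u) * H (u - z) \<partial>lborel) \<partial>lborel)"
      by (rule lborel_pair.Fubini') measurable
    also have "\<dots> = (\<integral>\<^sup>+u. H u * H (u - z) \<partial>lborel)"
      by (simp add: nn_integral_multc H_def[symmetric])
    finally show ?thesis .
  qed
  show "(\<integral>\<^sup>+x. (\<integral>\<^sup>+y. g x * k (x - y - z) * g y \<partial>lborel) \<partial>lborel)
        \<le> (\<integral>\<^sup>+x. (\<integral>\<^sup>+y. g x * k (x - y) * g y \<partial>lborel) \<partial>lborel)"
    using *[of z] *[of 0] nn_integral_autocorrelation_le[of H z] by simp
qed measurable

lemma shift_dominated_cmult:
  fixes k :: "real^'n::finite \<Rightarrow> ennreal"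
  assumes "shift_dominated k"
  shows "shift_dominated (\<lambda>x. c * k x)"
  unfolding shift_dominated_def
proof (intro conjI allI impI)
  have k[measurable]: "k \<in> borel_measurable borel" using assms by (simp add: shift_dominated_def)
  show "(\<lambda>x. c * k x) \<in> borel_measurable borel" by measurable
  fix g :: "real^'n \<Rightarrow> ennreal" and z
  assume [measurable]: "g \<in> borel_measurable borel"
  have "(\<integral>\<^sup>+x. (\<integral>\<^sup>+y. g x * (c * k (x - y - z)) * g y \<partial>lborel) \<partial>lborel)
      = c * (\<integral>\<^sup>+x. (\<integral>\<^sup>+y. g x * k (x - y - z) * g y \<partial>lborel) \<partial>lborel)" for z
  proof -
    have "(\<integral>\<^sup>+x. (\<integral>\<^sup>+y. g x * (c * k (x - y - z)) * g y \<partial>lborel) \<partial>lborel)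
      = (\<integral>\<^sup>+x. (\<integral>\<^sup>+y. c * (g x * k (x - y - z) * g y) \<partial>lborel) \<partial>lborel)"
      by (simp add: mult_ac)
    also have "\<dots> = c * (\<integral>\<^sup>+x. (\<integral>\<^sup>+y. g x * k (x - y - z) * g y \<partial>lborel) \<partial>lborel)"
      by (simp add: nn_integral_cmult)
    finally show ?thesis .
  qed
  from this[of z] this[of 0] show "(\<integral>\<^sup>+x. (\<integral>\<^sup>+y. g x * (c * k (x - y - z)) * g y \<partial>lborel) \<partial>lborel)
    \<le> (\<integral>\<^sup>+x. (\<integral>\<^sup>+y. g x * (c * k (x - y)) * g y \<partial>lborel) \<partial>lborel)"
    using shift_dominatedD[OF assms, of g z] by (auto intro: mult_left_mono)
qed

lemma shift_dominated_gaussian: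
  assumes "\<And>i. a i > 0"
  shows "shift_dominated (\<lambda>x. ennreal (gaussian a x))"
proof -
  define c where "c = (\<Prod>i\<in>UNIV. sqrt (pi / (4 * a i)))"
  have c: "c > 0" using assms by (auto simp: c_def intro!: prod_pos)
  have "shift_dominated (\<lambda>x. ennreal c * ennreal (gaussian a x))"
    using gaussian_conv_gaussian[OF assms]
    by (intro shift_dominated_autoconvolution[where A="\<lambda>x. ennreal (gaussian (\<lambda>i. 2 * a i) x)"])
       (auto simp: c_def)
  from shift_dominated_cmult[OF this, of "ennreal (1 / c)"] show ?thesis
    using c by (simp add: ennreal_mult[symmetric])
qed

lemma shift_dominated_mixture:
  fixes \<kappa> :: "'m \<Rightarrow> real^'n::finite \<Rightarrow> ennreal"
  assumes "sigma_finite_measure M"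
    and [measurable]: "(\<lambda>(m, x). \<kappa> m x) \<in> borel_measurable (M \<Otimes>\<^sub>M borel)"
    and dom: "\<And>m. m \<in> space M \<Longrightarrow> shift_dominated (\<kappa> m)"
  shows "shift_dominated (\<lambda>x. \<integral>\<^sup>+m. \<kappa> m x \<partial>M)"
proof -
  interpret M: sigma_finite_measure M by fact
  interpret P: pair_sigma_finite M "lborel :: (real^'n) measure" ..
  have [measurable]: "(\<lambda>x. \<integral>\<^sup>+m. \<kappa> m x \<partial>M) \<in> borel_measurable borel" by measurable
  show ?thesis
    unfolding shift_dominated_def
  proof (intro conjI allI impI)
    fix g :: "real^'n \<Rightarrow> ennreal" and z
    assume [measurable]: "g \<in> borel_measurable borel"
    have *: "(\<integral>\<^sup>+x. (\<integral>\<^sup>+y. g x * (\<integral>\<^sup>+m. \<kappa> m (x - y - z) \<partial>M) * g y \<partial>lborel) \<partial>lborel)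
      = (\<integral>\<^sup>+m. (\<integral>\<^sup>+x. (\<integral>\<^sup>+y. g x * \<kappa> m (x - y - z) * g y \<partial>lborel) \<partial>lborel) \<partial>M)" for z
    proof -
      have "(\<integral>\<^sup>+x. (\<integral>\<^sup>+y. g x * (\<integral>\<^sup>+m. \<kappa> m (x - y - z) \<partial>M) * g y \<partial>lborel) \<partial>lborel)
        = (\<integral>\<^sup>+x. (\<integral>\<^sup>+y. (\<integral>\<^sup>+m. g x * \<kappa> m (x - y - z) * g y \<partial>M) \<partial>lborel) \<partial>lborel)"
        by (simp add: nn_integral_cmult nn_integral_multc)
      also have "\<dots> = (\<integral>\<^sup>+x. (\<integral>\<^sup>+m. (\<integral>\<^sup>+y. g x * \<kappa> m (x - y - z) * g y \<partial>lborel) \<partial>M) \<partial>lborel)"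
        by (intro nn_integral_cong P.Fubini') measurable
      also have "\<dots> = (\<integral>\<^sup>+m. (\<integral>\<^sup>+x. (\<integral>\<^sup>+y. g x * \<kappa> m (x - y - z) * g y \<partial>lborel) \<partial>lborel) \<partial>M)"
        by (intro P.Fubini') measurable
      finally show ?thesis .
    qed
    show "(\<integral>\<^sup>+x. (\<integral>\<^sup>+y. g x * (\<integral>\<^sup>+m. \<kappa> m (x - y - z) \<partial>M) * g y \<partial>lborel) \<partial>lborel)
        \<le> (\<integral>\<^sup>+x. (\<integral>\<^sup>+y. g x * (\<integral>\<^sup>+m. \<kappa> m (x - y) \<partial>M) * g y \<partial>lborel) \<partial>lborel)"
      unfolding * *[of 0, simplified]
      by (rule nn_integral_mono, rule shift_dominatedD[OF dom]) auto
  qed measurable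
qed

text \<open>
  Smoothing averages the translates of the kernel with respect to a probability density.
\<close>
lemma pair_energy_smoothing_le:
  fixes k :: "real^'n::finite \<Rightarrow> ennreal"
  assumes k: "shift_dominated k" and [measurable]: "f \<in> borel_measurable borel"
  shows "pair_energy (gauss_convolution k) f \<le> pair_energy k f"
proof -
  have [measurable]: "k \<in> borel_measurable borel" using k by (simp add: shift_dominated_def)
  define g where "g x = ennreal ((f x)\<^sup>2)" for x
  have [measurable]: "g \<in> borel_measurable borel" unfolding g_def by measurable
  have "pair_energy (gauss_convolution k) f
    = (\<integral>\<^sup>+x. (\<integral>\<^sup>+y. (\<integral>\<^sup>+z. (g x * k (x - y - z) * g y) * ennreal (gauss z) \<partial>lborel) \<partial>lborel) \<partial>lborel)"
    unfolding pair_energy_def gauss_convolution_def g_def[symmetric]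
    by (simp add: nn_integral_cmult[symmetric] nn_integral_multc[symmetric] mult_ac)
  also have "\<dots> = (\<integral>\<^sup>+x. (\<integral>\<^sup>+z. (\<integral>\<^sup>+y. (g x * k (x - y - z) * g y) * ennreal (gauss z) \<partial>lborel) \<partial>lborel) \<partial>lborel)"
    by (intro nn_integral_cong lborel_pair.Fubini') measurable
  also have "\<dots> = (\<integral>\<^sup>+z. (\<integral>\<^sup>+x. (\<integral>\<^sup>+y. (g x * k (x - y - z) * g y) * ennreal (gauss z) \<partial>lborel) \<partial>lborel) \<partial>lborel)"
    by (intro lborel_pair.Fubini') measurable
  also have "\<dots> = (\<integral>\<^sup>+z. (\<integral>\<^sup>+x. (\<integral>\<^sup>+y. g x * k (x - y - z) * g y \<partial>lborel) \<partial>lborel) * ennreal (gauss z) \<partial>lborel)"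
    by (simp add: nn_integral_multc)
  also have "\<dots> \<le> (\<integral>\<^sup>+z. pair_energy k f * ennreal (gauss z) \<partial>(lborel :: (real^'n) measure))"
  proof (rule nn_integral_mono)
    fix z :: "real^'n"
    show "(\<integral>\<^sup>+x. (\<integral>\<^sup>+y. g x * k (x - y - z) * g y \<partial>lborel) \<partial>lborel) * ennreal (gauss z)
        \<le> pair_energy k f * ennreal (gauss z)"
      unfolding pair_energy_def g_def[symmetric]
      by (rule mult_right_mono[OF shift_dominatedD[OF k]]) auto
  qed
  also have "\<dots> = pair_energy k f"
    by (simp add: nn_integral_cmult nn_integral_gauss)
  finally show ?thesis .
qed

section \<open>Power kernels as superpositions of Gaussians\<close>

text \<open>
  The Gaussian superpositions below are infinite where the powers are singular, whereas
  \<open>0 powr a = 0\<close>.  The two disagree only on the coordinate hyperplanes, which are null sets.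
\<close>
lemma AE_lborel_coordinates_neq:
  fixes x :: "real^'n::finite"
  shows "AE y in lborel. \<forall>i. (x - y) $ i \<noteq> 0"
proof -
  have "AE y in lborel. (x - y) $ i \<noteq> 0" for i
  proof -
    have "{y :: real^'n. y $ i = x $ i} \<in> null_sets lebesgue"
      using negligible_standard_hyperplane[of "axis i 1 :: real^'n" "x $ i"]
      by (simp add: negligible_iff_null_sets axis_in_Basis_iff cart_eq_inner_axis)
    then have "{y :: real^'n. y $ i = x $ i} \<in> null_sets lborel"
      by (subst (asm) null_sets_completion_iff) auto
    then have "AE y in lborel. y \<notin> {y :: real^'n. y $ i = x $ i}"
      by (rule AE_not_in)
    then show ?thesis by eventually_elim auto
  qed
  then show ?thesis by (subst AE_all_countable) auto
qed

lemma borel_measurable_vec_component [measurable (raw)]: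
  fixes h :: "'a \<Rightarrow> real^'n::finite"
  assumes [measurable]: "h \<in> borel_measurable M"
  shows "(\<lambda>x. h x $ i) \<in> borel_measurable M"
  unfolding cart_eq_inner_axis by measurable

text \<open>
  The kernel \<open>k'\<close> stands for the Gaussian superposition and \<open>k\<close> for the kernel that vanishes on
  the singular set.
\<close>
lemma pair_energy_smoothing_le_off_hyperplanes:
  fixes k k' :: "real^'n::finite \<Rightarrow> ennreal"
  assumes k': "shift_dominated k'" and f: "f \<in> borel_measurable borel"
    and le: "\<And>x. k x \<le> k' x" and eq: "\<And>x. (\<And>i. x $ i \<noteq> 0) \<Longrightarrow> k x = k' x"
  shows "pair_energy (gauss_convolution k) f \<le> pair_energy k f"
proof -
  have "pair_energy (gauss_convolution k) f \<le> pair_energy (gauss_convolution k') f"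
    unfolding pair_energy_def gauss_convolution_def
    by (intro nn_integral_mono mult_right_mono mult_left_mono le) auto
  also have "\<dots> \<le> pair_energy k' f"
    by (rule pair_energy_smoothing_le[OF k' f])
  also have "\<dots> = pair_energy k f"
    unfolding pair_energy_def
  proof (rule nn_integral_cong, rule nn_integral_cong_AE)
    fix x :: "real^'n"
    show "AE y in lborel. ennreal ((f x)\<^sup>2) * k' (x - y) * ennreal ((f y)\<^sup>2)
      = ennreal ((f x)\<^sup>2) * k (x - y) * ennreal ((f y)\<^sup>2)"
      using AE_lborel_coordinates_neq[of x] by eventually_elim (simp add: eq)
  qed
  finally show ?thesis .
qed

text \<open>
  The density of the Gamma distribution without its exponential factor, so that its Laplace
  transform at \<open>r\<^sup>2\<close> is exactly \<open>\<bar>r\<bar> powr (- 2 * a)\<close>.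
\<close>
definition gamma_weight :: "real \<Rightarrow> real \<Rightarrow> real" where
  "gamma_weight a s = (if s > 0 then s powr (a - 1) / Gamma a else 0)"

lemma gamma_weight_nonneg: "a > 0 \<Longrightarrow> 0 \<le> gamma_weight a s"
  by (auto simp: gamma_weight_def Gamma_real_pos less_imp_le)

lemma borel_measurable_gamma_weight [measurable]: "gamma_weight a \<in> borel_measurable borel"
  unfolding gamma_weight_def by measurable

text \<open>
  Substitute \<open>t = s r\<^sup>2\<close> in Euler's integral for \<open>\<Gamma>(w / 2)\<close>.
\<close>
lemma powr_eq_gaussian_mixture:
  fixes r w :: real
  assumes r: "r \<noteq> 0" and w: "w > 0"
  shows "(\<integral>\<^sup>+s. ennreal (gamma_weight (w / 2) s * exp (- (s * r\<^sup>2))) \<partial>lborel) = ennreal (\<bar>r\<bar> powr (- w))"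
proof -
  define a where "a = w / 2"
  define F where "F t = ennreal (indicator {0..} t * t powr (a - 1) / exp t)" for t :: real
  define I where "I = (\<integral>\<^sup>+s. ennreal (gamma_weight a s * exp (- (s * r\<^sup>2))) \<partial>lborel)"
  have a: "a > 0" and G: "Gamma a > 0" using w by (auto simp: a_def Gamma_real_pos)
  have [measurable]: "F \<in> borel_measurable borel" unfolding F_def by measurable
  have "ennreal (Gamma a) = (\<integral>\<^sup>+t. F t \<partial>lborel)"
    unfolding F_def by (rule Gamma_conv_nn_integral_real[OF a])
  also have "\<dots> = ennreal (r\<^sup>2) * (\<integral>\<^sup>+s. F (0 + r\<^sup>2 * s) \<partial>lborel)"
    using r by (subst nn_integral_real_affine[where c = "r\<^sup>2" and t = 0]) auto
  also have "(\<integral>\<^sup>+s. F (0 + r\<^sup>2 * s) \<partial>lborel)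
      = (\<integral>\<^sup>+s. ennreal (Gamma a * (r\<^sup>2) powr (a - 1)) * ennreal (gamma_weight a s * exp (- (s * r\<^sup>2))) \<partial>lborel)"
  proof (intro nn_integral_cong)
    fix s :: real
    have "indicator {0..} (r\<^sup>2 * s) * (r\<^sup>2 * s) powr (a - 1) / exp (r\<^sup>2 * s)
      = Gamma a * (r\<^sup>2) powr (a - 1) * (gamma_weight a s * exp (- (s * r\<^sup>2)))"
      using r G by (auto simp: gamma_weight_def indicator_def powr_mult exp_minus field_simps zero_le_mult_iff)
    then show "F (0 + r\<^sup>2 * s) = ennreal (Gamma a * (r\<^sup>2) powr (a - 1)) * ennreal (gamma_weight a s * exp (- (s * r\<^sup>2)))"
      using G by (simp add: F_def ennreal_mult'[symmetric] del: mult_minus_left)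
  qed
  also have "\<dots> = ennreal (Gamma a * (r\<^sup>2) powr (a - 1)) * I"
    unfolding I_def by (intro nn_integral_cmult) measurable
  also have "ennreal (r\<^sup>2) * \<dots> = ennreal (Gamma a * \<bar>r\<bar> powr w) * I"
  proof -
    have "r\<^sup>2 * (r\<^sup>2) powr (a - 1) = (r\<^sup>2) powr a" using r by (simp add: powr_diff)
    also have "\<dots> = \<bar>r\<bar> powr w"
    proof -
      have "(r\<^sup>2) powr a = (\<bar>r\<bar> powr 2) powr a" using r by simp
      then show ?thesis by (simp only: powr_powr) (simp add: a_def)
    qed
    finally have "r\<^sup>2 * (Gamma a * (r\<^sup>2) powr (a - 1)) = Gamma a * \<bar>r\<bar> powr w"
      by (simp add: mult.left_commute)
    then have "ennreal (r\<^sup>2) * ennreal (Gamma a * (r\<^sup>2) powr (a - 1)) = ennreal (Gamma a * \<bar>r\<bar> powr w)"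
      by (subst ennreal_mult'[symmetric]) (auto simp only: zero_le_power2)
    then show ?thesis
      by (simp only: mult.assoc[symmetric])
  qed
  finally have *: "ennreal (Gamma a * \<bar>r\<bar> powr w) * I = ennreal (Gamma a)" by simp
  have "I = ennreal (1 / (Gamma a * \<bar>r\<bar> powr w)) * (ennreal (Gamma a * \<bar>r\<bar> powr w) * I)"
    using G r by (simp add: mult.assoc[symmetric] ennreal_mult'[symmetric])
  also have "\<dots> = ennreal (\<bar>r\<bar> powr (- w))"
    unfolding * using G r by (simp add: ennreal_mult'[symmetric] powr_minus_divide)
  finally show ?thesis by (simp add: I_def a_def)
qed

lemma gaussian_const: "gaussian (\<lambda>_. s) x = exp (- (s * (norm x)\<^sup>2))"
  by (simp add: gaussian_def norm_vec_def L2_set_def sum_nonneg sum_distrib_left)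

lemma shift_dominated_zero: "shift_dominated (\<lambda>x. 0)"
  by (simp add: shift_dominated_def)

text \<open>
  The Riesz kernel superposes the isotropic Gaussians \<open>exp (- s \<bar>x\<bar>\<^sup>2)\<close>.
\<close>
lemma smoothing_le_riesz:
  fixes f :: "real^'n::finite \<Rightarrow> real"
  assumes w: "w > 0" and f: "f \<in> borel_measurable borel"
  shows "pair_energy (gauss_convolution (riesz_kernel \<sigma> w)) f \<le> pair_energy (riesz_kernel \<sigma> w) f"
proof -
  define mix :: "real^'n \<Rightarrow> ennreal" where "mix x = (\<integral>\<^sup>+s. ennreal (\<sigma>\<^sup>2 * gamma_weight (w/2) s) * ennreal (gaussian (\<lambda>_. s) x) \<partial>lborel)" for x
  have eq: "riesz_kernel \<sigma> w x = mix x" if "x \<noteq> 0" for x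
  proof -
    have "mix x = (\<integral>\<^sup>+s. ennreal (\<sigma>\<^sup>2) * ennreal (gamma_weight (w / 2) s * exp (- (s * (norm x)\<^sup>2))) \<partial>lborel)"
      unfolding mix_def by (intro nn_integral_cong) (use w in \<open>simp add: gaussian_const ennreal_mult gamma_weight_nonneg mult.assoc\<close>)
    also have "\<dots> = riesz_kernel \<sigma> w x"
      using powr_eq_gaussian_mixture[of "norm x" w] that w
      by (subst nn_integral_cmult) (auto simp: riesz_kernel_def ennreal_mult)
    finally show ?thesis ..
  qed
  show ?thesis
  proof (rule pair_energy_smoothing_le_off_hyperplanes[OF _ f])
    show "shift_dominated mix"
      unfolding mix_def
    proof (rule shift_dominated_mixture)
      fix s :: real
      show "shift_dominated (\<lambda>x::real^'n. ennreal (\<sigma>\<^sup>2 * gamma_weight (w/2) s) * ennreal (gaussian (\<lambda>_. s) x))"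
        by (cases "s > 0")
           (auto intro!: shift_dominated_cmult shift_dominated_gaussian simp: gamma_weight_def[of _ s] shift_dominated_zero)
    qed (simp_all add: gaussian_const sigma_finite_lborel)
    show "riesz_kernel \<sigma> w x \<le> mix x" for x
      using eq[of x] by (cases "x = 0") (simp_all add: riesz_kernel_def[of _ _ 0])
    show "riesz_kernel \<sigma> w x = mix x" if "\<And>i. x $ i \<noteq> 0" for x
      using that by (intro eq) auto
  qed
qed

text \<open>
  The fractional kernel superposes anisotropic Gaussians, with an independent parameter for each
  coordinate.
\<close>
lemma smoothing_le_fractional:
  fixes f :: "real^'n::finite \<Rightarrow> real"
  assumes w: "\<And>i. w i > 0" and f: "f \<in> borel_measurable borel"
  shows "pair_energy (gauss_convolution (fractional_kernel \<sigma> w)) f \<le> pair_energy (fractional_kernel \<sigma> w) f"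
proof -
  let ?M = "Pi\<^sub>M UNIV (\<lambda>_::'n. lborel :: real measure)"
  interpret product_sigma_finite "\<lambda>_::'n. lborel :: real measure" ..
  interpret finite_product_sigma_finite "\<lambda>_::'n. lborel :: real measure" "UNIV" by standard simp
  define weight where "weight s = \<sigma>\<^sup>2 * (\<Prod>i\<in>UNIV. gamma_weight (w i / 2) (s i))" for s
  define mix :: "real^'n \<Rightarrow> ennreal" where "mix x = (\<integral>\<^sup>+s. ennreal (weight s) * ennreal (gaussian s x) \<partial>?M)" for x
  have eq: "fractional_kernel \<sigma> w x = mix x" if "\<And>i. x $ i \<noteq> 0" for x
  proof -
    have "mix x = (\<integral>\<^sup>+s. ennreal (\<sigma>\<^sup>2) * (\<Prod>i\<in>UNIV. ennreal (gamma_weight (w i / 2) (s i) * exp (- (s i * (x $ i)\<^sup>2)))) \<partial>?M)"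
      unfolding mix_def
    proof (rule nn_integral_cong)
      fix s
      show "ennreal (weight s) * ennreal (gaussian s x)
        = ennreal (\<sigma>\<^sup>2) * (\<Prod>i\<in>UNIV. ennreal (gamma_weight (w i / 2) (s i) * exp (- (s i * (x $ i)\<^sup>2))))"
        using w by (simp add: weight_def gaussian_def exp_sum sum_negf[symmetric] prod_ennreal gamma_weight_nonneg
            ennreal_mult'[symmetric] prod_nonneg prod.distrib mult.assoc)
    qed
    also have "\<dots> = ennreal (\<sigma>\<^sup>2) * (\<Prod>i\<in>UNIV. \<integral>\<^sup>+s. ennreal (gamma_weight (w i / 2) s * exp (- (s * (x $ i)\<^sup>2))) \<partial>lborel)"
      by (subst nn_integral_cmult, measurable)
         (subst product_nn_integral_prod[where f="\<lambda>i s. ennreal (gamma_weight (w i / 2) s * exp (- (s * (x $ i)\<^sup>2)))"], simp_all)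
    also have "\<dots> = fractional_kernel \<sigma> w x"
      using that w by (simp add: powr_eq_gaussian_mixture prod_ennreal fractional_kernel_def ennreal_mult prod_nonneg)
    finally show ?thesis ..
  qed
  show ?thesis
  proof (rule pair_energy_smoothing_le_off_hyperplanes[OF _ f])
    show "shift_dominated mix"
      unfolding mix_def
    proof (rule shift_dominated_mixture)
      fix s :: "'n \<Rightarrow> real"
      show "shift_dominated (\<lambda>x. ennreal (weight s) * ennreal (gaussian s x))"
      proof (cases "\<forall>i. s i > 0")
        case True
        then show ?thesis by (intro shift_dominated_cmult shift_dominated_gaussian) auto
      next
        case False
        then have "weight s = 0" by (auto simp: weight_def gamma_weight_def intro!: prod_zero)
        then show ?thesis by (simp add: shift_dominated_zero)
      qed
    next
      show "sigma_finite_measure ?M" ..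
    next
      show "(\<lambda>(s, x). ennreal (weight s) * ennreal (gaussian s x)) \<in> borel_measurable (?M \<Otimes>\<^sub>M borel)"
        unfolding weight_def gaussian_def by measurable
    qed
    show "fractional_kernel \<sigma> w x \<le> mix x" for x
    proof (cases "\<forall>i. x $ i \<noteq> 0")
      case False
      then have *: "(\<Prod>i\<in>UNIV. \<bar>x $ i\<bar> powr (- w i)) = 0" by (subst prod_zero_iff) auto
      show ?thesis unfolding fractional_kernel_def * by simp
    qed (simp add: eq)
    show "fractional_kernel \<sigma> w x = mix x" if "\<And>i. x $ i \<noteq> 0" for x
      using that by (intro eq) auto
  qed
qed

text \<open>
  For white noise the smoothed energy is the average of the autocorrelation of \<open>f\<^sup>2\<close>, and its
  value at \<open>0\<close> is \<open>\<integral> f\<^sup>4\<close>.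
\<close>
lemma smoothing_le_white:
  fixes f :: "real^'n::finite \<Rightarrow> real"
  assumes [measurable]: "f \<in> borel_measurable borel"
  shows "pair_energy (smoothed_kernel \<sigma> White) f \<le> noise_energy \<sigma> White f"
proof -
  define g where "g x = ennreal ((f x)\<^sup>2)" for x
  have [measurable]: "g \<in> borel_measurable borel" unfolding g_def by measurable
  have gg: "g x * g x = ennreal ((f x) ^ 4)" for x
    by (simp add: g_def ennreal_mult[symmetric] power_add[symmetric])
  have "pair_energy (smoothed_kernel \<sigma> White) f
    = (\<integral>\<^sup>+z. ennreal (\<sigma>\<^sup>2 * gauss z) * (\<integral>\<^sup>+x. g x * g (x - z) \<partial>lborel) \<partial>lborel)"
    unfolding pair_energy_def g_def[symmetric] smoothed_kernel.simps
    by (rule nn_integral_pair_correlation) measurable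
  also have "\<dots> \<le> (\<integral>\<^sup>+z. ennreal (\<sigma>\<^sup>2 * gauss z) * (\<integral>\<^sup>+x. g x * g x \<partial>lborel) \<partial>(lborel :: (real^'n) measure))"
    by (rule nn_integral_mono, rule mult_left_mono, rule nn_integral_autocorrelation_le) auto
  also have "\<dots> = ennreal (\<sigma>\<^sup>2) * (\<integral>\<^sup>+z. ennreal (gauss z) \<partial>(lborel :: (real^'n) measure)) * (\<integral>\<^sup>+x. g x * g x \<partial>lborel)"
    by (simp add: ennreal_mult nn_integral_multc nn_integral_cmult)
  also have "\<dots> = noise_energy \<sigma> White f"
    by (simp add: nn_integral_gauss gg)
  finally show ?thesis .
qed

lemma smoothed_energy_le_noise_energy:
  fixes f :: "real^'n::finite \<Rightarrow> real"
  assumes "admissible \<gamma>" "f \<in> borel_measurable borel"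
  shows "pair_energy (smoothed_kernel \<sigma> \<gamma>) f \<le> noise_energy \<sigma> \<gamma> f"
  using assms smoothing_le_white[of f \<sigma>] smoothing_le_riesz[of _ f \<sigma>] smoothing_le_fractional[of _ f \<sigma>]
  by (cases \<gamma>) auto

section \<open>Boundedness of the smoothed kernels\<close>

text \<open>
  Within distance \<open>1\<close> of the singularity the density is at most \<open>1\<close> and the power is integrable;
  further away the power is at most \<open>1\<close> and the density has mass \<open>1\<close>.
\<close>
lemma powr_gauss_convolution_bounded:
  fixes w :: real
  assumes w: "0 < w" "w < 1"
  shows "(\<integral>\<^sup>+t. ennreal (\<bar>r - t\<bar> powr (- w) * std_normal_density t) \<partial>lborel) \<le> ennreal (2 / (1 - w) + 1)"
proof -
  \<comment> \<open>one-sided, so that \<open>A (r - t)\<close> and \<open>A (t - r)\<close> cover the two sides of the singularity\<close>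
  define A where "A z = ennreal (z powr (- w)) * indicator {0..1} z" for z :: real
  have [measurable]: "A \<in> borel_measurable borel" unfolding A_def by measurable
  have IA: "(\<integral>\<^sup>+z. A z \<partial>lborel) = ennreal (1 / (1 - w))"
    unfolding A_def using has_integral_powr_from_0[of "- w" 1] w
    by (subst nn_integral_has_integral_lebesgue'[where I="1 / (1 - w)"]) auto
  have n1: "std_normal_density t \<le> 1" for t
  proof -
    have "1 \<le> sqrt (2 * pi)" using pi_gt3 by (simp add: real_le_rsqrt)
    moreover have "exp (- t\<^sup>2 / 2) \<le> 1" by simp
    ultimately have "exp (- t\<^sup>2 / 2) \<le> sqrt (2 * pi)" by (rule order_trans[rotated])
    then have "exp (- t\<^sup>2 / 2) / sqrt (2 * pi) \<le> 1" by (simp add: divide_le_eq)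
    then show ?thesis by (simp add: std_normal_density_def)
  qed
  have pw: "ennreal (\<bar>r - t\<bar> powr (- w) * std_normal_density t)
      \<le> A (r - t) + A (t - r) + ennreal (std_normal_density t)" for t
  proof (cases "\<bar>r - t\<bar> \<le> 1")
    case True
    have "ennreal (\<bar>r - t\<bar> powr (- w) * std_normal_density t) \<le> ennreal (\<bar>r - t\<bar> powr (- w))"
      using n1[of t] by (intro ennreal_leI mult_left_le) auto
    also have "\<dots> \<le> A (r - t) + A (t - r)"
      using True by (cases "r \<ge> t") (auto simp: A_def)
    finally show ?thesis by (simp add: add_increasing2)
  next
    case False
    then have "\<bar>r - t\<bar> powr (- w) \<le> 1"
      using powr_mono2'[of "- w" 1 "\<bar>r - t\<bar>"] w by simp
    then have "ennreal (\<bar>r - t\<bar> powr (- w) * std_normal_density t) \<le> ennreal (std_normal_density t)"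
      by (intro ennreal_leI mult_left_le_one_le) auto
    then show ?thesis by (simp add: add_increasing)
  qed
  have N: "(\<integral>\<^sup>+t. ennreal (std_normal_density t) \<partial>lborel) = 1"
    using integral_normal_density[of 1 0] by (subst nn_integral_eq_integral) auto
  have "(\<integral>\<^sup>+t. ennreal (\<bar>r - t\<bar> powr (- w) * std_normal_density t) \<partial>lborel)
      \<le> (\<integral>\<^sup>+t. A (r - t) + A (t - r) + ennreal (std_normal_density t) \<partial>lborel)"
    by (intro nn_integral_mono pw)
  also have "\<dots> = ennreal (1 / (1 - w)) + ennreal (1 / (1 - w)) + 1"
    by (simp add: nn_integral_add nn_integral_lborel_reflect nn_integral_lborel_translate IA N)
  also have "\<dots> = ennreal (1 / (1 - w) + 1 / (1 - w) + 1)"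
    using w by (simp add: ennreal_plus[symmetric] del: ennreal_plus ennreal_1 add: ennreal_1[symmetric])
  finally show ?thesis by simp
qed

lemma prod_mono_ennreal:
  fixes u v :: "'i \<Rightarrow> ennreal"
  assumes "\<And>i. i \<in> I \<Longrightarrow> u i \<le> v i"
  shows "prod u I \<le> prod v I"
  using assms by (induction I rule: infinite_finite_induct) (auto intro!: mult_mono)

lemma fractional_smoothing_bounded:
  fixes w :: "'n::finite \<Rightarrow> real"
  assumes w: "\<And>i. 0 < w i" "\<And>i. w i < 1"
  shows "gauss_convolution (fractional_kernel \<sigma> w) x \<le> ennreal (\<sigma>\<^sup>2 * (\<Prod>i\<in>UNIV. 2 / (1 - w i) + 1))"
proof -
  have nonneg: "0 \<le> 2 / (1 - w i) + 1" for i
    using w(2)[of i] by simp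
  have "gauss_convolution (fractional_kernel \<sigma> w) x
    = (\<integral>\<^sup>+y. ennreal (\<sigma>\<^sup>2) * (\<Prod>i\<in>UNIV. ennreal (\<bar>x $ i - y $ i\<bar> powr (- w i) * std_normal_density (y $ i))) \<partial>lborel)"
    unfolding gauss_convolution_def fractional_kernel_def gauss_prod
    by (intro nn_integral_cong)
       (simp add: prod_ennreal ennreal_mult'[symmetric] prod.distrib mult.assoc prod_nonneg)
  also have "\<dots> = ennreal (\<sigma>\<^sup>2) * (\<Prod>i\<in>UNIV. \<integral>\<^sup>+t. ennreal (\<bar>x $ i - t\<bar> powr (- w i) * std_normal_density t) \<partial>lborel)"
    by (subst nn_integral_cmult, measurable)
       (subst nn_integral_vec_prod[where h="\<lambda>i t. ennreal (\<bar>x $ i - t\<bar> powr (- w i) * std_normal_density t)"], simp_all)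
  also have "\<dots> \<le> ennreal (\<sigma>\<^sup>2) * (\<Prod>i\<in>UNIV. ennreal (2 / (1 - w i) + 1))"
    using w by (intro mult_left_mono prod_mono_ennreal powr_gauss_convolution_bounded) auto
  also have "\<dots> = ennreal (\<sigma>\<^sup>2 * (\<Prod>i\<in>UNIV. 2 / (1 - w i) + 1))"
    using nonneg by (simp add: prod_ennreal ennreal_mult' prod_nonneg del: ennreal_plus)
  finally show ?thesis .
qed

text \<open>
  Since \<open>\<bar>z\<bar> \<ge> \<bar>z\<^sub>i\<bar>\<close> for every \<open>i\<close>, spreading the exponent evenly over the coordinates gives
  \<open>\<bar>z\<bar> powr (- w) \<le> \<Prod>\<^sub>i \<bar>z\<^sub>i\<bar> powr (- w / d)\<close>.  For \<open>w < d\<close> this dominates a Riesz kernel by an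
  admissible fractional one.
\<close>
lemma riesz_smoothing_le_fractional:
  assumes w: "w > 0"
  shows "gauss_convolution (riesz_kernel \<sigma> w) (x :: real^'n::finite)
    \<le> gauss_convolution (fractional_kernel \<sigma> (\<lambda>_. w / CARD('n))) x"
  unfolding gauss_convolution_def
proof (rule nn_integral_mono_AE)
  let ?v = "w / CARD('n)"
  have "riesz_kernel \<sigma> w z \<le> fractional_kernel \<sigma> (\<lambda>_. ?v) z" if z: "\<And>i. z $ i \<noteq> 0" for z :: "real^'n"
  proof -
    have "0 < norm z" using z by auto
    have "norm z powr (- w) = (\<Prod>i\<in>(UNIV::'n set). norm z powr (- ?v))"
      using \<open>0 < norm z\<close> by (simp add: powr_realpow[symmetric] powr_powr)
    also have "\<dots> \<le> (\<Prod>i\<in>UNIV. \<bar>z $ i\<bar> powr (- ?v))"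
      using w z component_le_norm_cart[of z] by (intro prod_mono conjI powr_mono2') auto
    finally show ?thesis
      unfolding riesz_kernel_def fractional_kernel_def by (intro ennreal_leI mult_left_mono) auto
  qed
  then show "AE y in lborel. riesz_kernel \<sigma> w (x - y) * ennreal (gauss y)
      \<le> fractional_kernel \<sigma> (\<lambda>_. ?v) (x - y) * ennreal (gauss y)"
    using AE_lborel_coordinates_neq[of x] by (auto intro!: mult_right_mono)
qed

lemma smoothed_kernel_bounded:
  fixes \<gamma> :: "'n::finite noise"
  assumes "admissible \<gamma>"
  obtains B where "B \<ge> 0" "\<And>x. smoothed_kernel \<sigma> \<gamma> x \<le> ennreal B"
proof -
  have "\<exists>B. \<forall>x. smoothed_kernel \<sigma> \<gamma> x \<le> ennreal B"
  proof (cases \<gamma>)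
    case White
    have "smoothed_kernel \<sigma> \<gamma> x \<le> ennreal (\<sigma>\<^sup>2 * (2 * pi) powr (- real CARD('n) / 2))" for x
      unfolding White smoothed_kernel.simps gauss_def by (intro ennreal_leI mult_left_mono mult_left_le) auto
    then show ?thesis by blast
  next
    case (Riesz w)
    let ?v = "\<lambda>_::'n. w / CARD('n)"
    have w: "0 < w" "0 < ?v i" "?v i < 1" for i using assms Riesz by auto
    show ?thesis
      unfolding Riesz smoothed_kernel.simps
      using order_trans[OF riesz_smoothing_le_fractional[OF w(1)] fractional_smoothing_bounded[of ?v, OF w(2,3)]]
      by blast
  next
    case (Fractional w)
    have w: "0 < w i" "w i < 1" for i using assms Fractional by auto
    show ?thesis
      unfolding Fractional smoothed_kernel.simps
      using fractional_smoothing_bounded[of w, OF w] by blast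
  qed
  then obtain B where B: "smoothed_kernel \<sigma> \<gamma> x \<le> ennreal B" for x by blast
  have "smoothed_kernel \<sigma> \<gamma> x \<le> ennreal \<bar>B\<bar>" for x
    by (rule order_trans[OF B]) (simp add: ennreal_leI)
  then show ?thesis by (intro that[of "\<bar>B\<bar>"]) auto
qed

section \<open>Recovering the singular energy from small-scale smoothing\<close>

lemma mult_liminf_le_ennreal:
  fixes F :: "nat \<Rightarrow> ennreal"
  shows "c * liminf F \<le> liminf (\<lambda>n. c * F n)"
  unfolding liminf_SUP_INF SUP_mult_left_ennreal
  by (intro SUP_mono' INF_greatest mult_left_mono INF_lower) auto

lemma pair_energy_liminf:
  assumes [measurable]: "\<And>n. K n \<in> borel_measurable borel" "f \<in> borel_measurable borel"
    and le: "\<And>x. k x \<le> liminf (\<lambda>n. K n x)"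
  shows "pair_energy k (f :: real^'n \<Rightarrow> real) \<le> liminf (\<lambda>n. pair_energy (K n) f)"
proof -
  define g where "g x = ennreal ((f x)\<^sup>2)" for x
  have [measurable]: "g \<in> borel_measurable borel" unfolding g_def by measurable
  have "g x * k (x - y) * g y \<le> liminf (\<lambda>n. g x * K n (x - y) * g y)" for x y
    using mult_left_mono[OF le[of "x - y"], of "g x * g y"] mult_liminf_le_ennreal[of "g x * g y" "\<lambda>n. K n (x - y)"]
    by (simp add: mult_ac)
  then have "pair_energy k f \<le> (\<integral>\<^sup>+x. (\<integral>\<^sup>+y. liminf (\<lambda>n. g x * K n (x - y) * g y) \<partial>lborel) \<partial>lborel)"
    unfolding pair_energy_def g_def[symmetric] by (intro nn_integral_mono)
  also have "\<dots> \<le> (\<integral>\<^sup>+x. liminf (\<lambda>n. \<integral>\<^sup>+y. g x * K n (x - y) * g y \<partial>lborel) \<partial>lborel)"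
    by (rule nn_integral_mono, rule nn_integral_liminf) measurable
  also have "\<dots> \<le> liminf (\<lambda>n. \<integral>\<^sup>+x. (\<integral>\<^sup>+y. g x * K n (x - y) * g y \<partial>lborel) \<partial>lborel)"
    by (rule nn_integral_liminf) measurable
  finally show ?thesis by (simp add: pair_energy_def g_def)
qed

text \<open>
  Homogeneity of degree \<open>- 2\<close> turns zooming in by the factor \<open>c\<close> into smoothing by a Gaussian of
  width \<open>1 / c\<close>, and Fatou's lemma bounds the limit inferior from below by
  lower semicontinuity of the kernel.
\<close>
lemma gauss_convolution_rescaled_liminf:
  fixes k :: "real^'n::finite \<Rightarrow> ennreal"
  assumes [measurable]: "k \<in> borel_measurable borel"
    and hom: "\<And>c x. c > 0 \<Longrightarrow> ennreal (c\<^sup>2) * k (c *\<^sub>R x) = k x"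
    and lsc: "\<And>x h. h \<longlonglongrightarrow> 0 \<Longrightarrow> k x \<le> liminf (\<lambda>n. k (x - h n))"
    and c: "\<And>n. c n > 0" "(\<lambda>n. 1 / c n) \<longlonglongrightarrow> 0"
  shows "k x \<le> liminf (\<lambda>n. ennreal ((c n)\<^sup>2) * gauss_convolution k (c n *\<^sub>R x))"
proof -
  have resc: "ennreal ((c n)\<^sup>2) * gauss_convolution k (c n *\<^sub>R x)
      = (\<integral>\<^sup>+z. ennreal (gauss z) * k (x - (1 / c n) *\<^sub>R z) \<partial>lborel)" for n
  proof -
    have "ennreal ((c n)\<^sup>2) * gauss_convolution k (c n *\<^sub>R x)
        = (\<integral>\<^sup>+z. ennreal ((c n)\<^sup>2) * (k (c n *\<^sub>R x - z) * ennreal (gauss z)) \<partial>lborel)"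
      unfolding gauss_convolution_def by (rule nn_integral_cmult[symmetric]) measurable
    also have "\<dots> = (\<integral>\<^sup>+z. ennreal (gauss z) * k (x - (1 / c n) *\<^sub>R z) \<partial>lborel)"
    proof (rule nn_integral_cong)
      fix z
      have "c n *\<^sub>R x - z = c n *\<^sub>R (x - (1 / c n) *\<^sub>R z)"
        using c(1)[of n] by (simp add: scaleR_diff_right)
      then show "ennreal ((c n)\<^sup>2) * (k (c n *\<^sub>R x - z) * ennreal (gauss z))
          = ennreal (gauss z) * k (x - (1 / c n) *\<^sub>R z)"
        using hom[OF c(1)[of n], of "x - (1 / c n) *\<^sub>R z"] by (metis mult.assoc mult.commute)
    qed
    finally show ?thesis .
  qed
  have "k x = (\<integral>\<^sup>+z. ennreal (gauss z) * k x \<partial>(lborel :: (real^'n) measure))"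
    by (simp add: nn_integral_multc nn_integral_gauss)
  also have "\<dots> \<le> (\<integral>\<^sup>+z. liminf (\<lambda>n. ennreal (gauss z) * k (x - (1 / c n) *\<^sub>R z)) \<partial>(lborel :: (real^'n) measure))"
  proof (rule nn_integral_mono)
    fix z :: "real^'n"
    have "(\<lambda>n. (1 / c n) *\<^sub>R z) \<longlonglongrightarrow> 0"
      using tendsto_scaleR[OF c(2) tendsto_const[of z]] by simp
    from lsc[OF this, of x]
    show "ennreal (gauss z) * k x \<le> liminf (\<lambda>n. ennreal (gauss z) * k (x - (1 / c n) *\<^sub>R z))"
      by (intro order_trans[OF mult_left_mono mult_liminf_le_ennreal]) auto
  qed
  also have "\<dots> \<le> liminf (\<lambda>n. \<integral>\<^sup>+z. ennreal (gauss z) * k (x - (1 / c n) *\<^sub>R z) \<partial>lborel)"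
    by (rule nn_integral_liminf) measurable
  finally show ?thesis by (simp add: resc)
qed

text \<open>
  The kernel is continuous off its singular set and takes its least value \<open>0\<close> on it, owing to
  \<open>0 powr a = 0\<close>.
\<close>
lemma riesz_kernel_lsc:
  assumes h: "h \<longlonglongrightarrow> (0 :: real^'n::finite)"
  shows "riesz_kernel \<sigma> w x \<le> liminf (\<lambda>n. riesz_kernel \<sigma> w (x - h n))"
proof (cases "x = 0")
  case False
  have "(\<lambda>n. x - h n) \<longlonglongrightarrow> x"
    using tendsto_diff[OF tendsto_const[of x] h] by simp
  then have "(\<lambda>n. riesz_kernel \<sigma> w (x - h n)) \<longlonglongrightarrow> riesz_kernel \<sigma> w x"
    unfolding riesz_kernel_def using False
    by (intro tendsto_ennrealI tendsto_intros) auto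
  then show ?thesis by (simp add: lim_imp_Liminf)
qed (simp add: riesz_kernel_def)

lemma fractional_kernel_lsc:
  assumes h: "h \<longlonglongrightarrow> (0 :: real^'n::finite)"
  shows "fractional_kernel \<sigma> w x \<le> liminf (\<lambda>n. fractional_kernel \<sigma> w (x - h n))"
proof (cases "\<forall>i. x $ i \<noteq> 0")
  case True
  have "(\<lambda>n. x - h n) \<longlonglongrightarrow> x"
    using tendsto_diff[OF tendsto_const[of x] h] by simp
  then have "(\<lambda>n. fractional_kernel \<sigma> w (x - h n)) \<longlonglongrightarrow> fractional_kernel \<sigma> w x"
    unfolding fractional_kernel_def using True
    by (intro tendsto_ennrealI tendsto_intros) auto
  then show ?thesis by (simp add: lim_imp_Liminf)
next
  case False
  then have *: "(\<Prod>i\<in>UNIV. \<bar>x $ i\<bar> powr (- w i)) = 0" by (subst prod_zero_iff) auto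
  show ?thesis unfolding fractional_kernel_def * by simp
qed

lemma riesz_kernel_homogeneous:
  assumes "c > 0"
  shows "ennreal (c\<^sup>2) * riesz_kernel \<sigma> 2 (c *\<^sub>R x) = riesz_kernel \<sigma> 2 x"
  using assms by (simp add: riesz_kernel_def ennreal_mult'[symmetric] powr_mult powr_minus_divide)

lemma fractional_kernel_homogeneous:
  fixes w :: "'n::finite \<Rightarrow> real"
  assumes c: "c > 0" and w: "(\<Sum>i\<in>UNIV. w i) = 2"
  shows "ennreal (c\<^sup>2) * fractional_kernel \<sigma> w (c *\<^sub>R x) = fractional_kernel \<sigma> w x"
proof -
  have "(\<Prod>i\<in>UNIV. c powr (- w i)) = c powr (- 2)"
    using c w by (simp add: powr_sum[symmetric] sum_negf)
  then have "c\<^sup>2 * (\<Prod>i\<in>UNIV. c powr (- w i)) = 1"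
    using c by (simp add: powr_minus_divide)
  then show ?thesis
    using c by (simp add: fractional_kernel_def ennreal_mult'[symmetric] abs_mult powr_mult prod.distrib mult_ac)
      (simp add: mult.assoc[symmetric] mult.commute)
qed

lemma borel_measurable_riesz_kernel [measurable]: "riesz_kernel \<sigma> w \<in> borel_measurable borel"
  unfolding riesz_kernel_def by measurable

lemma borel_measurable_fractional_kernel [measurable]: "fractional_kernel \<sigma> w \<in> borel_measurable borel"
  unfolding fractional_kernel_def by measurable

lemma borel_measurable_gauss_convolution [measurable]:
  assumes [measurable]: "k \<in> borel_measurable borel"
  shows "gauss_convolution k \<in> borel_measurable borel"
  unfolding gauss_convolution_def by measurable

text \<open>
  Shrink to \<open>D = A \<inter> B\<close> and enlarge one copy of \<open>D\<close> to an open \<open>U\<close> with \<open>U - D\<close> of measure less than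
  \<open>e\<close>.  Indicators of open sets are lower semicontinuous, so Fatou's lemma applies to the pair
  \<open>D\<close>, \<open>U\<close>, and replacing \<open>U\<close> by \<open>D\<close> costs at most \<open>e\<close>, whatever the translation.
\<close>
lemma measure_Int_translate_lsc:
  fixes A B :: "'a::euclidean_space set"
  assumes [measurable]: "A \<in> sets borel" "B \<in> sets borel" and h: "h \<longlonglongrightarrow> 0"
  shows "emeasure lborel (A \<inter> B) \<le> liminf (\<lambda>n. \<integral>\<^sup>+x. indicator A x * indicator B (x - h n) \<partial>lborel)"
  unfolding le_Liminf_iff
proof (intro allI impI)
  fix y assume "y < emeasure lborel (A \<inter> B)"
  then obtain y' where y': "y < y'" "y' < emeasure lborel (A \<inter> B)"
    using dense by blast
  then obtain a b where ab: "y = ennreal a" "y' = ennreal b" "0 \<le> a" "a < b"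
    by (cases y; cases y') (auto simp: ennreal_less_iff)
  \<comment> \<open>the gap that enlarging one set to \<open>U\<close> may cost\<close>
  define e where "e = b - a"
  have e: "e > 0" "y' = y + ennreal e" using ab by (auto simp: e_def ennreal_plus[symmetric] simp del: ennreal_plus)
  define D where "D = A \<inter> B"
  have [measurable]: "D \<in> sets borel" by (simp add: D_def)
  obtain U where U: "open U" "D \<subseteq> U" "emeasure lborel (U - D) < ennreal e"
    using outer_regular_lborel[of D e] e by auto
  have [measurable]: "U \<in> sets borel" using U by auto
  have "emeasure lborel D = (\<integral>\<^sup>+x. indicator D x \<partial>lborel)" by simp
  also have "\<dots> \<le> (\<integral>\<^sup>+x. liminf (\<lambda>n. indicator D x * indicator U (x - h n)) \<partial>lborel)"
  proof (rule nn_integral_mono)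
    fix x :: 'a
    show "indicator D x \<le> liminf (\<lambda>n. indicator D x * indicator U (x - h n) :: ennreal)"
    proof (cases "x \<in> D")
      case True
      have "(\<lambda>n. x - h n) \<longlonglongrightarrow> x" using tendsto_diff[OF tendsto_const[of x] h] by simp
      then have "\<forall>\<^sub>F n in sequentially. x - h n \<in> U"
        using U True by (auto dest: topological_tendstoD)
      then show ?thesis using True by (intro Liminf_bounded) (auto elim: eventually_mono)
    qed auto
  qed
  also have "\<dots> \<le> liminf (\<lambda>n. \<integral>\<^sup>+x. indicator D x * indicator U (x - h n) \<partial>lborel)"
    by (rule nn_integral_liminf) measurable
  finally have "\<forall>\<^sub>F n in sequentially. y' < (\<integral>\<^sup>+x. indicator D x * indicator U (x - h n) \<partial>lborel)"
    using y'(2) unfolding le_Liminf_iff D_def by auto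
  then show "\<forall>\<^sub>F n in sequentially. y < (\<integral>\<^sup>+x. indicator A x * indicator B (x - h n) \<partial>lborel)"
  proof eventually_elim
    fix n
    let ?T = "\<integral>\<^sup>+x. indicator A x * indicator B (x - h n) \<partial>lborel"
    assume "y' < (\<integral>\<^sup>+x. indicator D x * indicator U (x - h n) \<partial>lborel)"
    also have "\<dots> \<le> (\<integral>\<^sup>+x. indicator A x * indicator B (x - h n) + indicator (U - D) (x - h n) \<partial>lborel)"
      by (intro nn_integral_mono) (auto simp: D_def split: split_indicator)
    also have "\<dots> = ?T + (\<integral>\<^sup>+x. indicator (U - D) x \<partial>lborel)"
      using nn_integral_lborel_translate[of "indicator (U - D)" "h n"] by (simp add: nn_integral_add)
    also have "\<dots> = ?T + emeasure lborel (U - D)"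
      by simp
    also have "\<dots> \<le> ?T + ennreal e" using U by (intro add_left_mono) auto
    finally show "y < ?T"
      by (simp add: e(2) ennreal_add_left_cancel_less add.commute[of _ "ennreal e"])
  qed
qed

text \<open>
  Layer-cake decomposition of both factors into superlevel sets reduces the claim to
  \<open>measure_Int_translate_lsc\<close> and Fatou's lemma in each of the two levels.
\<close>
lemma autocorrelation_lsc:
  fixes F :: "'a::euclidean_space \<Rightarrow> real"
  assumes [measurable]: "F \<in> borel_measurable borel" and F: "\<And>x. 0 \<le> F x" and h: "h \<longlonglongrightarrow> 0"
  shows "(\<integral>\<^sup>+x. ennreal (F x) * ennreal (F x) \<partial>lborel)
    \<le> liminf (\<lambda>n. \<integral>\<^sup>+x. ennreal (F x) * ennreal (F (x - h n)) \<partial>lborel)"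
proof -
  define A where "A s = {x. 0 < s \<and> s < F x}" for s :: real
  have [measurable]: "A s \<in> sets borel" for s unfolding A_def by measurable
  have [measurable (raw)]: "Measurable.pred M (\<lambda>p. u p \<in> A (v p))"
    if [measurable]: "u \<in> borel_measurable M" "v \<in> borel_measurable M"
    for M :: "'b measure" and u v
    unfolding A_def by simp
  have layer: "ennreal (F x) = (\<integral>\<^sup>+s. indicator (A s) x \<partial>lborel)" for x
  proof -
    have "(\<integral>\<^sup>+s. indicator (A s) x \<partial>lborel) = (\<integral>\<^sup>+s. indicator {0<..<F x} s \<partial>lborel)"
      by (intro nn_integral_cong) (auto simp: A_def split: split_indicator)
    then show ?thesis using F[of x] by simp
  qed
  have corr: "(\<integral>\<^sup>+x. ennreal (F x) * ennreal (F (x - u)) \<partial>lborel)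
      = (\<integral>\<^sup>+s. (\<integral>\<^sup>+t. (\<integral>\<^sup>+x. indicator (A s) x * indicator (A t) (x - u) \<partial>lborel) \<partial>lborel) \<partial>lborel)" for u
  proof -
    have "(\<integral>\<^sup>+x. ennreal (F x) * ennreal (F (x - u)) \<partial>lborel)
      = (\<integral>\<^sup>+x. (\<integral>\<^sup>+s. indicator (A s) x * ennreal (F (x - u)) \<partial>lborel) \<partial>lborel)"
      by (subst layer) (simp add: nn_integral_multc)
    also have "\<dots> = (\<integral>\<^sup>+s. (\<integral>\<^sup>+x. indicator (A s) x * ennreal (F (x - u)) \<partial>lborel) \<partial>lborel)"
      by (rule lborel_pair.Fubini') measurable
    also have "\<dots> = (\<integral>\<^sup>+s. (\<integral>\<^sup>+x. (\<integral>\<^sup>+t. indicator (A s) x * indicator (A t) (x - u) \<partial>lborel) \<partial>lborel) \<partial>lborel)"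
      by (subst layer) (simp add: nn_integral_cmult)
    also have "\<dots> = (\<integral>\<^sup>+s. (\<integral>\<^sup>+t. (\<integral>\<^sup>+x. indicator (A s) x * indicator (A t) (x - u) \<partial>lborel) \<partial>lborel) \<partial>lborel)"
      by (rule nn_integral_cong, rule lborel_pair.Fubini') measurable
    finally show ?thesis .
  qed
  have int: "(\<integral>\<^sup>+x. indicator (A s) x * indicator (A t) (x - 0) \<partial>lborel) = emeasure lborel (A s \<inter> A t)" for s t
    by (simp add: indicator_inter_arith[symmetric])
  have "(\<integral>\<^sup>+x. ennreal (F x) * ennreal (F x) \<partial>lborel)
      = (\<integral>\<^sup>+s. (\<integral>\<^sup>+t. emeasure lborel (A s \<inter> A t) \<partial>lborel) \<partial>lborel)"
    using corr[of 0] unfolding int by simp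
  also have "\<dots> \<le> (\<integral>\<^sup>+s. (\<integral>\<^sup>+t. liminf (\<lambda>n. \<integral>\<^sup>+x. indicator (A s) x * indicator (A t) (x - h n) \<partial>lborel) \<partial>lborel) \<partial>lborel)"
    by (intro nn_integral_mono measure_Int_translate_lsc h) auto
  also have "\<dots> \<le> (\<integral>\<^sup>+s. liminf (\<lambda>n. \<integral>\<^sup>+t. (\<integral>\<^sup>+x. indicator (A s) x * indicator (A t) (x - h n) \<partial>lborel) \<partial>lborel) \<partial>lborel)"
    by (rule nn_integral_mono, rule nn_integral_liminf) measurable
  also have "\<dots> \<le> liminf (\<lambda>n. \<integral>\<^sup>+s. (\<integral>\<^sup>+t. (\<integral>\<^sup>+x. indicator (A s) x * indicator (A t) (x - h n) \<partial>lborel) \<partial>lborel) \<partial>lborel)"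
    by (rule nn_integral_liminf) measurable
  finally show ?thesis by (simp add: corr)
qed

text \<open>
  In dimension two, \<open>c\<^sup>2 p\<^sub>1 (c x)\<close> is the Gaussian density of width \<open>1 / c\<close>, so the rescaled energies
  average the autocorrelation of \<open>f\<^sup>2\<close> over translations that shrink to \<open>0\<close>.
\<close>
lemma white_energy_liminf:
  fixes f :: "real^'n::finite \<Rightarrow> real"
  assumes [measurable]: "f \<in> borel_measurable borel" and d: "CARD('n) = 2"
    and c: "\<And>n. c n > 0" "(\<lambda>n. 1 / c n) \<longlonglongrightarrow> 0"
  shows "noise_energy \<sigma> White f
    \<le> liminf (\<lambda>n. pair_energy (\<lambda>x. ennreal ((c n)\<^sup>2) * smoothed_kernel \<sigma> White (c n *\<^sub>R x)) f)"
proof -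
  define g where "g x = ennreal ((f x)\<^sup>2)" for x
  have [measurable]: "g \<in> borel_measurable borel" unfolding g_def by measurable
  have gg: "g x * g x = ennreal ((f x) ^ 4)" for x
    by (simp add: g_def ennreal_mult[symmetric] power_add[symmetric])
  define J where "J u = (\<integral>\<^sup>+x. g x * g (x - u) \<partial>lborel)" for u
  have [measurable]: "J \<in> borel_measurable borel" unfolding J_def by measurable
  have resc: "pair_energy (\<lambda>x. ennreal ((c n)\<^sup>2) * smoothed_kernel \<sigma> White (c n *\<^sub>R x)) f
    = (\<integral>\<^sup>+z. ennreal (\<sigma>\<^sup>2 * gauss z) * J ((1 / c n) *\<^sub>R z) \<partial>lborel)" for n
  proof -
    have "pair_energy (\<lambda>x. ennreal ((c n)\<^sup>2) * smoothed_kernel \<sigma> White (c n *\<^sub>R x)) f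
      = (\<integral>\<^sup>+z. (ennreal ((c n)\<^sup>2) * ennreal (\<sigma>\<^sup>2 * gauss (c n *\<^sub>R z))) * J z \<partial>lborel)"
      unfolding pair_energy_def g_def[symmetric] smoothed_kernel.simps J_def
      by (rule nn_integral_pair_correlation) measurable
    also have "\<dots> = ennreal (\<bar>c n\<bar> ^ DIM(real^'n)) * (\<integral>\<^sup>+z. ennreal (\<sigma>\<^sup>2 * gauss (0 + c n *\<^sub>R z)) * J ((1 / c n) *\<^sub>R (0 + c n *\<^sub>R z)) \<partial>lborel)"
      using c(1)[of n] d by (simp add: nn_integral_cmult mult.assoc)
    also have "\<dots> = (\<integral>\<^sup>+z. ennreal (\<sigma>\<^sup>2 * gauss z) * J ((1 / c n) *\<^sub>R z) \<partial>lborel)"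
      using c(1)[of n] by (intro nn_integral_lborel_affine[symmetric]) auto
    finally show ?thesis .
  qed
  have "noise_energy \<sigma> White f = ennreal (\<sigma>\<^sup>2) * (\<integral>\<^sup>+z. ennreal (gauss z) \<partial>(lborel :: (real^'n) measure)) * J 0"
    by (simp add: nn_integral_gauss gg J_def)
  also have "\<dots> = (\<integral>\<^sup>+z. ennreal (\<sigma>\<^sup>2 * gauss z) * J 0 \<partial>(lborel :: (real^'n) measure))"
    by (simp add: ennreal_mult nn_integral_multc nn_integral_cmult)
  also have "\<dots> \<le> (\<integral>\<^sup>+z. liminf (\<lambda>n. ennreal (\<sigma>\<^sup>2 * gauss z) * J ((1 / c n) *\<^sub>R z)) \<partial>(lborel :: (real^'n) measure))"
  proof (rule nn_integral_mono)
    fix z :: "real^'n"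
    have "(\<lambda>n. (1 / c n) *\<^sub>R z) \<longlonglongrightarrow> 0"
      using tendsto_scaleR[OF c(2) tendsto_const[of z]] by simp
    then have "J 0 \<le> liminf (\<lambda>n. J ((1 / c n) *\<^sub>R z))"
      using autocorrelation_lsc[of "\<lambda>x. (f x)\<^sup>2" "\<lambda>n. (1 / c n) *\<^sub>R z"] by (simp add: J_def g_def)
    then show "ennreal (\<sigma>\<^sup>2 * gauss z) * J 0 \<le> liminf (\<lambda>n. ennreal (\<sigma>\<^sup>2 * gauss z) * J ((1 / c n) *\<^sub>R z))"
      by (intro order_trans[OF mult_left_mono mult_liminf_le_ennreal]) auto
  qed
  also have "\<dots> \<le> liminf (\<lambda>n. \<integral>\<^sup>+z. ennreal (\<sigma>\<^sup>2 * gauss z) * J ((1 / c n) *\<^sub>R z) \<partial>lborel)"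
    by (rule nn_integral_liminf) measurable
  finally show ?thesis by (simp only: resc)
qed

lemma noise_energy_le_liminf:
  fixes \<gamma> :: "'n::finite noise"
  assumes f[measurable]: "f \<in> borel_measurable borel" and \<gamma>: "scaling_exponent \<gamma> = 2"
    and c: "\<And>n. c n > 0" "(\<lambda>n. 1 / c n) \<longlonglongrightarrow> 0"
  shows "noise_energy \<sigma> \<gamma> f
    \<le> liminf (\<lambda>n. pair_energy (\<lambda>x. ennreal ((c n)\<^sup>2) * smoothed_kernel \<sigma> \<gamma> (c n *\<^sub>R x)) f)"
proof (cases \<gamma>)
  case White
  then show ?thesis using white_energy_liminf[OF f _ c, of \<sigma>] \<gamma> by simp
next
  case (Riesz w)
  then have w: "w = 2" using \<gamma> by simp
  show ?thesis
    unfolding Riesz w noise_energy.simps smoothed_kernel.simps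
    by (intro pair_energy_liminf gauss_convolution_rescaled_liminf riesz_kernel_lsc riesz_kernel_homogeneous c) measurable
next
  case (Fractional w)
  then have w: "sum w UNIV = 2" using \<gamma> by simp
  show ?thesis
    unfolding Fractional noise_energy.simps smoothed_kernel.simps
    by (intro pair_energy_liminf gauss_convolution_rescaled_liminf fractional_kernel_lsc fractional_kernel_homogeneous c w) measurable
qed

section \<open>Dilations of \<open>H\<^sup>1\<close> functions\<close>

lemma partial_deriv_scaled:
  fixes \<phi> :: "real^'n::finite \<Rightarrow> real"
  assumes "\<phi> differentiable (at (r *\<^sub>R x))"
  shows "(\<lambda>x. a * \<phi> (r *\<^sub>R x)) differentiable (at x)"
    and "partial_deriv i (\<lambda>x. a * \<phi> (r *\<^sub>R x)) x = (a * r) * partial_deriv i \<phi> (r *\<^sub>R x)"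
proof -
  obtain D where D: "(\<phi> has_derivative D) (at (r *\<^sub>R x))"
    using assms by (auto simp: differentiable_def)
  have "((\<lambda>x. \<phi> (r *\<^sub>R x)) has_derivative (\<lambda>h. D (r *\<^sub>R h))) (at x)"
    by (rule has_derivative_compose[of "\<lambda>x. r *\<^sub>R x" "\<lambda>h. r *\<^sub>R h", OF _ D])
       (auto intro!: derivative_eq_intros)
  then have *: "((\<lambda>x. a * \<phi> (r *\<^sub>R x)) has_derivative (\<lambda>h. a * D (r *\<^sub>R h))) (at x)"
    by (rule has_derivative_mult_right)
  then show "(\<lambda>x. a * \<phi> (r *\<^sub>R x)) differentiable (at x)"
    by (auto simp: differentiable_def)
  have "linear D" using D by (rule has_derivative_linear)
  then show "partial_deriv i (\<lambda>x. a * \<phi> (r *\<^sub>R x)) x = (a * r) * partial_deriv i \<phi> (r *\<^sub>R x)"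
    unfolding partial_deriv_def frechet_derivative_at[OF *, symmetric] frechet_derivative_at[OF D, symmetric]
    by (simp add: linear_scale)
qed

lemma k_times_cont_diff_scaled:
  fixes \<phi> :: "real^'n::finite \<Rightarrow> real"
  assumes "k_times_cont_diff k \<phi>"
  shows "k_times_cont_diff k (\<lambda>x. a * \<phi> (r *\<^sub>R x))"
  using assms
proof (induction k arbitrary: \<phi> a)
  case 0
  then show ?case
    by (auto intro!: continuous_intros continuous_on_compose2[of UNIV \<phi>])
next
  case (Suc k)
  then have d: "\<phi> differentiable (at x)" for x by simp
  have "partial_deriv i (\<lambda>x. a * \<phi> (r *\<^sub>R x)) = (\<lambda>x. (a * r) * partial_deriv i \<phi> (r *\<^sub>R x))" for i
    by (rule ext) (rule partial_deriv_scaled(2)[OF d])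
  then show ?case
    using Suc unfolding k_times_cont_diff.simps
    by (intro conjI allI partial_deriv_scaled(1) d) (simp_all add: Suc.IH)
qed

lemma test_function_scaled:
  fixes \<phi> :: "real^'n::finite \<Rightarrow> real"
  assumes \<phi>: "test_function \<phi>" and r: "r \<noteq> 0"
  shows "test_function (\<lambda>x. \<phi> (r *\<^sub>R x))"
proof -
  have "{x. \<phi> (r *\<^sub>R x) \<noteq> 0} = (\<lambda>x. (1 / r) *\<^sub>R x) ` {x. \<phi> x \<noteq> 0}"
  proof (intro equalityI subsetI)
    fix x assume "x \<in> {x. \<phi> (r *\<^sub>R x) \<noteq> 0}"
    then show "x \<in> (\<lambda>x. (1 / r) *\<^sub>R x) ` {x. \<phi> x \<noteq> 0}"
      using r by (intro image_eqI[of _ _ "r *\<^sub>R x"]) auto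
  qed (use r in auto)
  then have "compact (closure {x. \<phi> (r *\<^sub>R x) \<noteq> 0})"
    using \<phi> by (simp add: closure_scaleR[symmetric] compact_scaling test_function_def)
  moreover have "k_times_cont_diff k (\<lambda>x. \<phi> (r *\<^sub>R x))" for k
    using k_times_cont_diff_scaled[of k \<phi> 1 r] \<phi> by (simp add: test_function_def)
  ultimately show ?thesis by (simp add: test_function_def)
qed

lemma test_functionD:
  fixes \<phi> :: "real^'n::finite \<Rightarrow> real"
  assumes "test_function \<phi>"
  shows "\<phi> differentiable (at x)" "continuous_on UNIV \<phi>" "continuous_on UNIV (partial_deriv i \<phi>)"
proof -
  have k: "k_times_cont_diff 0 \<phi>" "k_times_cont_diff 1 \<phi>" using assms unfolding test_function_def by blast+
  show "\<phi> differentiable (at x)" "continuous_on UNIV \<phi>" "continuous_on UNIV (partial_deriv i \<phi>)"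
    using k by auto
qed

lemma has_weak_gradient_scaled:
  fixes f :: "real^'n::finite \<Rightarrow> real"
  assumes fD: "has_weak_gradient f Df" and c: "c > 0"
    and [measurable]: "f \<in> borel_measurable borel" "Df \<in> borel_measurable borel"
  shows "has_weak_gradient (\<lambda>x. a * f (c *\<^sub>R x)) (\<lambda>x. (a * c) *\<^sub>R Df (c *\<^sub>R x))"
  unfolding has_weak_gradient_def
proof (intro allI impI)
  fix \<phi> :: "real^'n \<Rightarrow> real" and i
  assume \<phi>: "test_function \<phi>"
  define \<psi> where "\<psi> x = \<phi> ((1 / c) *\<^sub>R x)" for x
  have \<psi>: "test_function \<psi>"
    unfolding \<psi>_def using c by (intro test_function_scaled \<phi>) auto
  have [measurable]: "\<psi> \<in> borel_measurable borel" "partial_deriv i \<psi> \<in> borel_measurable borel"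
    using test_functionD[OF \<psi>] by (auto intro: borel_measurable_continuous_onI)
  have \<phi>_eq: "\<phi> = (\<lambda>x. 1 * \<psi> (c *\<^sub>R x))" using c by (auto simp: \<psi>_def)
  have p: "partial_deriv i \<phi> x = c * partial_deriv i \<psi> (c *\<^sub>R x)" for x
    by (subst \<phi>_eq, subst partial_deriv_scaled) (auto intro: test_functionD[OF \<psi>])
  have "(\<integral>x. a * f (c *\<^sub>R x) * partial_deriv i \<phi> x \<partial>lborel)
      = (a * c) * (\<integral>x. f (c *\<^sub>R x) * partial_deriv i \<psi> (c *\<^sub>R x) \<partial>lborel)"
    unfolding p integral_mult_right_zero[symmetric] by (simp add: mult_ac)
  also have "\<dots> = (a * c) * (- (\<integral>x. Df x $ i * \<psi> x \<partial>lborel) / c ^ CARD('n))"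
    using lborel_integral_scale[OF _ c, of "\<lambda>x. f x * partial_deriv i \<psi> x"] fD \<psi>
    by (simp add: has_weak_gradient_def)
  also have "\<dots> = - ((a * c) * (\<integral>x. Df (c *\<^sub>R x) $ i * \<psi> (c *\<^sub>R x) \<partial>lborel))"
    using lborel_integral_scale[OF _ c, of "\<lambda>x. Df x $ i * \<psi> x"] by simp
  also have "\<dots> = - (\<integral>x. ((a * c) *\<^sub>R Df (c *\<^sub>R x)) $ i * \<phi> x \<partial>lborel)"
    unfolding integral_mult_right_zero[symmetric] using c by (simp add: \<psi>_def mult_ac)
  finally show "(\<integral>x. a * f (c *\<^sub>R x) * partial_deriv i \<phi> x \<partial>lborel)
      = - (\<integral>x. ((a * c) *\<^sub>R Df (c *\<^sub>R x)) $ i * \<phi> x \<partial>lborel)" .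
qed

text \<open>
  The dilation that preserves the \<open>L\<^sup>2\<close> norm; the companion formula gives its gradient.
\<close>
definition dilate :: "real \<Rightarrow> (real^'n \<Rightarrow> real) \<Rightarrow> real^'n \<Rightarrow> real" where
  "dilate c f x = c powr (CARD('n) / 2) * f (c *\<^sub>R x)"

definition dilate_gradient :: "real \<Rightarrow> (real^'n \<Rightarrow> real^'n) \<Rightarrow> real^'n \<Rightarrow> real^'n" where
  "dilate_gradient c Df x = (c powr (CARD('n) / 2) * c) *\<^sub>R Df (c *\<^sub>R x)"

lemma powr_half_power2:
  assumes "c > 0"
  shows "(c powr (real d / 2))\<^sup>2 = c ^ d"
  using assms by (simp add: powr_realpow[symmetric] powr_powr power2_eq_square powr_add[symmetric])

lemma H1_unit_measurable:
  assumes "(f, Df) \<in> H1_unit"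
  shows "f \<in> borel_measurable borel" "Df \<in> borel_measurable borel"
  using assms by (auto simp: H1_unit_def L2_space_def)

lemma H1_unit_dilate:
  fixes f :: "real^'n::finite \<Rightarrow> real"
  assumes H: "(f, Df) \<in> H1_unit" and c: "c > 0"
  shows "(dilate c f, dilate_gradient c Df) \<in> H1_unit"
    and "gradient_energy (dilate_gradient c Df) = c\<^sup>2 * gradient_energy Df"
proof -
  note [measurable] = H1_unit_measurable[OF H]
  have i: "integrable lborel (\<lambda>x. (norm (f x))\<^sup>2)" "integrable lborel (\<lambda>x. (norm (Df x))\<^sup>2)"
    using H by (auto simp: H1_unit_def L2_space_def)
  have n: "(norm (dilate c f x))\<^sup>2 = c ^ CARD('n) * (norm (f (c *\<^sub>R x)))\<^sup>2" for x
    using c by (simp add: dilate_def power_mult_distrib powr_half_power2)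
  have nD: "(norm (dilate_gradient c Df x))\<^sup>2 = c\<^sup>2 * c ^ CARD('n) * (norm (Df (c *\<^sub>R x)))\<^sup>2" for x
    using c by (simp add: dilate_gradient_def power_mult_distrib powr_half_power2)
  have m: "dilate c f \<in> borel_measurable lborel" "dilate_gradient c Df \<in> borel_measurable lborel"
    unfolding dilate_def dilate_gradient_def by measurable
  have "(\<integral>x. (norm (dilate c f x))\<^sup>2 \<partial>lborel) = (\<integral>x. (norm (f x))\<^sup>2 \<partial>lborel)"
    unfolding n using lborel_integral_scale[OF _ c, of "\<lambda>x. (norm (f x))\<^sup>2"] c by simp
  then have l: "l2_norm (dilate c f) = 1"
    using H by (simp add: H1_unit_def l2_norm_def)
  have w: "has_weak_gradient (dilate c f) (dilate_gradient c Df)"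
    using has_weak_gradient_scaled[OF _ c, of f Df "c powr (CARD('n) / 2)"] H
    by (simp add: H1_unit_def dilate_def[abs_def] dilate_gradient_def[abs_def])
  have "integrable lborel (\<lambda>x. (norm (dilate c f x))\<^sup>2)" "integrable lborel (\<lambda>x. (norm (dilate_gradient c Df x))\<^sup>2)"
    unfolding n nD using lborel_integrable_scale[OF i(1) c] lborel_integrable_scale[OF i(2) c] by auto
  with m l w show "(dilate c f, dilate_gradient c Df) \<in> H1_unit"
    by (simp add: H1_unit_def L2_space_def)
  show "gradient_energy (dilate_gradient c Df) = c\<^sup>2 * gradient_energy Df"
    unfolding gradient_energy_def nD
    using lborel_integral_scale[OF _ c, of "\<lambda>x. (norm (Df x))\<^sup>2"] c by simp
qed

text \<open>
  Dilating the function by \<open>c\<close> amounts to dilating the kernel by \<open>1 / c\<close>.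
\<close>
lemma pair_energy_dilate:
  fixes f :: "real^'n::finite \<Rightarrow> real"
  assumes [measurable]: "f \<in> borel_measurable borel" "k \<in> borel_measurable borel" and c: "c > 0"
  shows "pair_energy k (dilate c f) = pair_energy (\<lambda>x. k ((1 / c) *\<^sub>R x)) f"
proof -
  define g where "g x = ennreal ((f x)\<^sup>2)" for x
  have [measurable]: "g \<in> borel_measurable borel" unfolding g_def by measurable
  define v where "v = ennreal (\<bar>c\<bar> ^ DIM(real^'n))"
  have g: "ennreal ((dilate c f x)\<^sup>2) = v * g (c *\<^sub>R x)" for x
    using c by (simp add: dilate_def power_mult_distrib powr_half_power2 g_def v_def ennreal_mult')
  have "pair_energy (\<lambda>x. k ((1 / c) *\<^sub>R x)) f
    = (\<integral>\<^sup>+x. (\<integral>\<^sup>+y. g x * k ((1 / c) *\<^sub>R (x - y)) * g y \<partial>lborel) \<partial>lborel)"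
    by (simp add: pair_energy_def g_def)
  also have "\<dots> = v * (\<integral>\<^sup>+x. (\<integral>\<^sup>+y. g (0 + c *\<^sub>R x) * k ((1 / c) *\<^sub>R (0 + c *\<^sub>R x - y)) * g y \<partial>lborel) \<partial>lborel)"
    unfolding v_def using c by (intro nn_integral_lborel_affine) auto
  also have "\<dots> = v * (\<integral>\<^sup>+x. v * (\<integral>\<^sup>+y. g (0 + c *\<^sub>R x) * k ((1 / c) *\<^sub>R (0 + c *\<^sub>R x - (0 + c *\<^sub>R y))) * g (0 + c *\<^sub>R y) \<partial>lborel) \<partial>lborel)"
    unfolding v_def using c
    by (intro arg_cong2[where f="(*)"] refl nn_integral_cong
        nn_integral_lborel_affine[of "\<lambda>y. g _ * k ((1 / c) *\<^sub>R (_ - y)) * g y"]) auto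
  also have "\<dots> = v * (\<integral>\<^sup>+x. v * (\<integral>\<^sup>+y. g (c *\<^sub>R x) * k (x - y) * g (c *\<^sub>R y) \<partial>lborel) \<partial>lborel)"
    using c by (simp add: scaleR_diff_right)
  also have "\<dots> = pair_energy k (dilate c f)"
    unfolding pair_energy_def g by (simp add: nn_integral_cmult[symmetric] mult_ac)
  finally show ?thesis ..
qed

section \<open>A function in the unit sphere of \<open>H\<^sup>1\<close>\<close>

text \<open>
  The difference quotients of \<open>u\<close> in direction \<open>e\<close> have integral \<open>0\<close> by translation invariance.
  They converge to the derivative, dominated by its maximum on a ball one unit larger than the
  support.
\<close>
lemma integral_directional_derivative_eq_0:
  fixes u :: "'a::euclidean_space \<Rightarrow> real"
  assumes deriv: "\<And>x. (u has_derivative D x) (at x)"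
    and cont: "continuous_on UNIV (\<lambda>x. D x e)"
    and supp: "\<And>x. norm x > R \<Longrightarrow> u x = 0" and e: "norm e \<le> 1"
  shows "integrable lborel (\<lambda>x. D x e)" "(\<integral>x. D x e \<partial>lborel) = 0"
proof -
  let ?S = "cball (0::'a) (R + 1)"
  have D0: "D x e = 0" if x: "norm x > R" for x
  proof -
    have "open {y :: 'a. norm y > R}" by (intro open_Collect_less continuous_intros)
    then have "((\<lambda>_. 0) has_derivative D x) (at x)"
      using x supp by (intro has_derivative_transform_within_open[OF deriv]) auto
    from has_derivative_unique[OF this has_derivative_const] show ?thesis by simp
  qed
  have int_supp: "integrable lborel g" if g: "continuous_on UNIV g" "\<And>x. norm x > R \<Longrightarrow> g x = 0" for g :: "'a \<Rightarrow> real"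
  proof -
    have "integrable lborel (\<lambda>x. indicator ?S x *\<^sub>R g x)"
      using g(1) by (intro borel_integrable_compact) (auto intro: continuous_on_subset)
    moreover have "(\<lambda>x. indicator ?S x *\<^sub>R g x) = g"
      using g(2) by (auto simp: fun_eq_iff indicator_def)
    ultimately show ?thesis by simp
  qed
  have u_cont: "continuous_on UNIV u"
    using deriv by (intro has_derivative_continuous_on) (auto intro: has_derivative_at_withinI)
  have u_int: "integrable lborel u" by (rule int_supp[OF u_cont supp])
  show D_int: "integrable lborel (\<lambda>x. D x e)" by (rule int_supp[OF cont D0])
  have "bounded ((\<lambda>x. D x e) ` ?S)"
    by (intro compact_imp_bounded compact_continuous_image) (auto intro: continuous_on_subset[OF cont])
  then obtain M where M: "M > 0" "\<And>x. x \<in> ?S \<Longrightarrow> \<bar>D x e\<bar> \<le> M"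
    unfolding bounded_pos by auto
  have M': "\<bar>D x e\<bar> \<le> M" for x
    using M D0[of x] by (cases "x \<in> ?S") auto
  define h where "h n = inverse (real (Suc n))" for n
  have h: "h n > 0" "h n \<le> 1" for n by (auto simp: h_def field_simps)
  have h0: "h \<longlonglongrightarrow> 0" unfolding h_def by (rule LIMSEQ_inverse_real_of_nat)
  define s where "s n x = (u (x + h n *\<^sub>R e) - u x) / h n" for n x
  have [measurable]: "u \<in> borel_measurable borel" using u_int by auto
  have [measurable]: "(\<lambda>x. D x e) \<in> borel_measurable borel" using D_int by auto
  have shift: "integrable lborel (\<lambda>x. u (x + t)) \<and> (\<integral>x. u (x + t) \<partial>lborel) = (\<integral>x. u x \<partial>lborel)" for t
  proof -
    have "integrable (distr lborel borel ((+) t)) u \<and> (\<integral>x. u x \<partial>distr lborel borel ((+) t)) = (\<integral>x. u x \<partial>lborel)"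
      using u_int by (simp add: lborel_distr_plus)
    then show ?thesis
      by (simp add: integrable_distr_eq integral_distr add.commute)
  qed
  have s_int: "(\<integral>x. s n x \<partial>lborel) = 0" for n
    using shift[of "h n *\<^sub>R e"] u_int by (simp add: s_def)
  have "(\<lambda>n. \<integral>x. s n x \<partial>lborel) \<longlonglongrightarrow> (\<integral>x. D x e \<partial>lborel)"
  proof (rule integral_dominated_convergence[where w="\<lambda>x. indicator ?S x *\<^sub>R M"])
    show "integrable lborel (\<lambda>x. indicator ?S x *\<^sub>R M)"
      by (intro borel_integrable_compact) auto
    show "AE x in lborel. (\<lambda>n. s n x) \<longlonglongrightarrow> D x e"
    proof (rule AE_I2)
      fix x
      have "((\<lambda>t. u (x + t *\<^sub>R e)) has_derivative (\<lambda>t. D x (t *\<^sub>R e))) (at 0)"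
        by (rule has_derivative_compose[of "\<lambda>t. x + t *\<^sub>R e" "\<lambda>t. t *\<^sub>R e" 0 UNIV u])
           (auto intro!: derivative_eq_intros simp: deriv)
      then have "((\<lambda>t. u (x + t *\<^sub>R e)) has_field_derivative D x e) (at 0)"
        unfolding has_field_derivative_def
        using linear_scale[OF has_derivative_linear[OF deriv[of x]]] by (simp add: mult.commute[of _ "D x e"])
      then have "((\<lambda>t. (u (x + t *\<^sub>R e) - u x) / t) \<longlongrightarrow> D x e) (at 0)"
        by (simp add: has_field_derivative_iff)
      moreover have "filterlim h (at 0) sequentially"
        using h h0 by (auto simp: filterlim_at intro!: always_eventually) (metis less_irrefl)
      ultimately show "(\<lambda>n. s n x) \<longlonglongrightarrow> D x e"
        unfolding s_def by (rule filterlim_compose)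
    qed
    show "AE x in lborel. norm (s n x) \<le> indicator ?S x *\<^sub>R M" for n
    proof (rule AE_I2)
      fix x
      have "\<exists>t\<in>{0<..<h n}. u (x + h n *\<^sub>R e) - u (x + 0 *\<^sub>R e) = D (x + t *\<^sub>R e) ((h n - 0) *\<^sub>R e)"
      proof (rule mvt_simple[OF h(1)[of n], of "\<lambda>t. u (x + t *\<^sub>R e)" "\<lambda>t r. D (x + t *\<^sub>R e) (r *\<^sub>R e)"])
        fix t
        show "((\<lambda>t. u (x + t *\<^sub>R e)) has_derivative (\<lambda>r. D (x + t *\<^sub>R e) (r *\<^sub>R e))) (at t within {0..h n})"
          by (rule has_derivative_compose[of "\<lambda>t. x + t *\<^sub>R e" "\<lambda>t. t *\<^sub>R e" t "{0..h n}" u])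
             (auto intro!: derivative_eq_intros simp: deriv)
      qed
      then obtain t where t: "u (x + h n *\<^sub>R e) - u x = h n * D (x + t *\<^sub>R e) e"
        using linear_scale[OF has_derivative_linear[OF deriv]] by auto
      then have "\<bar>s n x\<bar> \<le> M" using M' h(1)[of n] by (simp add: s_def)
      moreover have "s n x = 0" if "x \<notin> ?S"
      proof -
        have "norm (x + h n *\<^sub>R e) \<ge> norm x - norm (h n *\<^sub>R e)" by (rule norm_diff_ineq)
        moreover have "norm (h n *\<^sub>R e) \<le> 1" using h[of n] e by (simp add: mult_le_one)
        ultimately have "norm (x + h n *\<^sub>R e) > R" "norm x > R" using that by auto
        then show ?thesis by (simp add: s_def supp)
      qed
      ultimately show "norm (s n x) \<le> indicator ?S x *\<^sub>R M" by (auto simp: indicator_def)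
    qed
  qed (auto simp: s_def)
  then show "(\<integral>x. D x e \<partial>lborel) = 0" by (simp add: s_int LIMSEQ_const_iff)
qed

text \<open>
  Integration by parts: \<open>f \<phi>\<close> has compact support, so its partial derivative has integral \<open>0\<close>.
\<close>
lemma has_weak_gradient_classical:
  fixes f :: "real^'n::finite \<Rightarrow> real"
  assumes f: "\<And>x. (f has_derivative (\<lambda>h. Df x \<bullet> h)) (at x)" and Df: "continuous_on UNIV Df"
  shows "has_weak_gradient f Df"
  unfolding has_weak_gradient_def
proof (intro allI impI)
  fix \<phi> :: "real^'n \<Rightarrow> real" and i
  assume \<phi>: "test_function \<phi>"
  let ?e = "axis i 1 :: real^'n"
  have f_cont: "continuous_on UNIV f"
    using f by (intro has_derivative_continuous_on) (auto intro: has_derivative_at_withinI)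
  have \<phi>': "(\<phi> has_derivative frechet_derivative \<phi> (at x)) (at x)" for x
    using test_functionD(1)[OF \<phi>] by (simp add: frechet_derivative_works[symmetric])
  define E where "E x h = f x * frechet_derivative \<phi> (at x) h + (Df x \<bullet> h) * \<phi> x" for x h
  have E: "((\<lambda>x. f x * \<phi> x) has_derivative E x) (at x)" for x
    using has_derivative_mult[OF f \<phi>', of x] unfolding E_def .
  have c1: "continuous_on UNIV (\<lambda>x. f x * partial_deriv i \<phi> x)"
    and c2: "continuous_on UNIV (\<lambda>x. Df x $ i * \<phi> x)"
    using test_functionD[OF \<phi>] f_cont Df by (auto intro!: continuous_intros)
  have Ee: "E x ?e = f x * partial_deriv i \<phi> x + Df x $ i * \<phi> x" for x
    by (simp add: E_def partial_deriv_def cart_eq_inner_axis)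
  have "bounded (closure {x. \<phi> x \<noteq> 0})"
    using \<phi> by (auto simp: test_function_def compact_imp_bounded)
  then obtain R where R: "\<And>x. x \<in> closure {x. \<phi> x \<noteq> 0} \<Longrightarrow> norm x \<le> R"
    unfolding bounded_iff by auto
  have supp: "\<phi> x = 0" if "norm x > R" for x
    using R[of x] that closure_subset[of "{x. \<phi> x \<noteq> 0}"] by fastforce
  have "continuous_on UNIV (\<lambda>x. E x ?e)" unfolding Ee by (intro continuous_on_add c1 c2)
  then have E0: "integrable lborel (\<lambda>x. E x ?e)" "(\<integral>x. E x ?e \<partial>lborel) = 0"
    using integral_directional_derivative_eq_0[OF E, of ?e R] supp by auto
  have i2: "integrable lborel (\<lambda>x. Df x $ i * \<phi> x)"
  proof -
    have "integrable lborel (\<lambda>x. indicator (cball 0 R) x *\<^sub>R (Df x $ i * \<phi> x))"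
      using c2 by (intro borel_integrable_compact) (auto intro: continuous_on_subset)
    moreover have "(\<lambda>x. indicator (cball 0 R) x *\<^sub>R (Df x $ i * \<phi> x)) = (\<lambda>x. Df x $ i * \<phi> x)"
      using supp by (auto simp: fun_eq_iff indicator_def)
    ultimately show ?thesis by simp
  qed
  have "(\<integral>x. f x * partial_deriv i \<phi> x \<partial>lborel) = (\<integral>x. E x ?e - Df x $ i * \<phi> x \<partial>lborel)"
    by (simp add: Ee)
  also have "\<dots> = - (\<integral>x. Df x $ i * \<phi> x \<partial>lborel)"
    using E0 i2 by simp
  finally show "(\<integral>x. f x * partial_deriv i \<phi> x \<partial>lborel) = - (\<integral>x. Df x $ i * \<phi> x \<partial>lborel)" .
qed

text \<open>
  The square root of the standard Gaussian density.  Nonemptiness matters because the supremum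
  over the empty set would be \<open>- \<infinity>\<close> and not \<open>0\<close>.
\<close>
lemma H1_unit_nonempty: "(H1_unit :: ((real^'n::finite \<Rightarrow> real) \<times> _) set) \<noteq> {}"
proof -
  define A where "A = (2 * pi) powr (- real CARD('n) / 2)"
  have A: "A > 0" by (simp add: A_def)
  define f :: "real^'n \<Rightarrow> real" where "f x = sqrt A * exp (- (x \<bullet> x) / 4)" for x
  define Df :: "real^'n \<Rightarrow> real^'n" where "Df x = (- f x / 2) *\<^sub>R x" for x
  have "gauss x = A * exp (- (norm x)\<^sup>2 / 2)" for x :: "real^'n"
    by (simp add: gauss_def A_def)
  then have f2: "(norm (f x))\<^sup>2 = gauss x" for x
    using A by (simp add: f_def power_mult_distrib exp_of_nat_mult[symmetric] power2_norm_eq_inner)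
  have [measurable]: "f \<in> borel_measurable borel" unfolding f_def by measurable
  have [measurable]: "Df \<in> borel_measurable borel" unfolding Df_def by measurable
  have "integrable lborel (\<lambda>x :: real^'n. gauss x) \<and> (\<integral>x. gauss x \<partial>(lborel :: (real^'n) measure)) = 1"
    using nn_integral_gauss[where 'n='n]
    by (auto simp: integrable_iff_bounded integral_eq_nn_integral)
  then have 1: "f \<in> L2_space" "l2_norm f = 1"
    using f2 by (auto simp: L2_space_def l2_norm_def)
  \<comment> \<open>\<open>y \<le> exp y\<close> at \<open>y = (norm x)\<^sup>2 / 4\<close> absorbs the quadratic factor into a wider Gaussian\<close>
  have "integrable lborel (\<lambda>x. (norm (Df x))\<^sup>2)"
  proof (rule Bochner_Integration.integrable_bound)
    show "integrable lborel (\<lambda>x. A * gaussian (\<lambda>_. 1/4) (x :: real^'n))"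
      using nn_integral_gaussian[of "\<lambda>_::'n. 1/4"] by (auto simp: integrable_iff_bounded)
    show "AE x in lborel. norm ((norm (Df x))\<^sup>2) \<le> norm (A * gaussian (\<lambda>_. 1/4) x)"
    proof (rule AE_I2)
      fix x :: "real^'n"
      have "(norm (Df x))\<^sup>2 = (norm (f x))\<^sup>2 * ((norm x)\<^sup>2 / 4)"
        by (simp add: Df_def power_mult_distrib power_divide)
      also have "\<dots> \<le> gauss x * exp ((norm x)\<^sup>2 / 4)"
        unfolding f2
      proof (rule mult_left_mono)
        show "(norm x)\<^sup>2 / 4 \<le> exp ((norm x)\<^sup>2 / 4)"
          using exp_ge_add_one_self[of "(norm x)\<^sup>2 / 4"] by linarith
      qed simp
      also have "\<dots> = A * gaussian (\<lambda>_. 1/4) x"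
        by (simp add: gauss_def A_def gaussian_const exp_add[symmetric])
      finally show "norm ((norm (Df x))\<^sup>2) \<le> norm (A * gaussian (\<lambda>_. 1/4) x)" by simp
    qed
  qed auto
  then have 2: "Df \<in> L2_space" by (simp add: L2_space_def)
  have "(f has_derivative (\<lambda>h. Df x \<bullet> h)) (at x)" for x
    unfolding f_def Df_def
    by (auto intro!: derivative_eq_intros simp: fun_eq_iff inner_commute field_simps)
  moreover have "continuous_on UNIV Df"
    unfolding Df_def f_def by (intro continuous_intros) auto
  ultimately have "has_weak_gradient f Df"
    by (rule has_weak_gradient_classical)
  with 1 2 have "(f, Df) \<in> H1_unit" by (simp add: H1_unit_def)
  then show ?thesis by blast
qed

section \<open>The variational constant\<close>

lemma borel_measurable_smoothed_kernel [measurable]: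
  "smoothed_kernel \<sigma> \<gamma> \<in> borel_measurable borel"
  by (cases \<gamma>) simp_all

lemma gradient_energy_nonneg: "0 \<le> gradient_energy Df"
  unfolding gradient_energy_def by (rule integral_nonneg_AE) auto

lemma pair_energy_cmult:
  fixes f :: "real^'n::finite \<Rightarrow> real"
  assumes [measurable]: "f \<in> borel_measurable borel" "k \<in> borel_measurable borel"
  shows "pair_energy (\<lambda>x. a * k x) f = a * pair_energy k f"
proof -
  have "pair_energy (\<lambda>x. a * k x) f
    = (\<integral>\<^sup>+x. (\<integral>\<^sup>+y. a * (ennreal ((f x)\<^sup>2) * k (x - y) * ennreal ((f y)\<^sup>2)) \<partial>lborel) \<partial>lborel)"
    by (simp add: pair_energy_def mult_ac)
  then show ?thesis by (simp add: pair_energy_def nn_integral_cmult)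
qed

lemma pair_energy_le_of_bounded:
  fixes f :: "real^'n::finite \<Rightarrow> real"
  assumes H: "(f, Df) \<in> H1_unit" and k: "\<And>x. k x \<le> ennreal B"
  shows "pair_energy k f \<le> ennreal B"
proof -
  note [measurable] = H1_unit_measurable[OF H]
  have one: "(\<integral>\<^sup>+x. ennreal ((f x)\<^sup>2) \<partial>lborel) = 1"
    using H by (auto simp: H1_unit_def L2_space_def l2_norm_def nn_integral_eq_integral)
  have "pair_energy k f \<le> (\<integral>\<^sup>+x. (\<integral>\<^sup>+y. ennreal ((f x)\<^sup>2) * ennreal B * ennreal ((f y)\<^sup>2) \<partial>lborel) \<partial>lborel)"
    unfolding pair_energy_def by (intro nn_integral_mono mult_right_mono mult_left_mono k) auto
  also have "\<dots> = ennreal B"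
    by (simp add: nn_integral_cmult nn_integral_multc one)
  finally show ?thesis .
qed

definition smoothed_energy :: "real \<Rightarrow> 'n::finite noise \<Rightarrow> (real^'n \<Rightarrow> real) \<Rightarrow> real" where
  "smoothed_energy \<sigma> \<gamma> f = enn2real (pair_energy (smoothed_kernel \<sigma> \<gamma>) f)"

lemma smoothed_energy:
  fixes \<gamma> :: "'n::finite noise"
  assumes "admissible \<gamma>" "(f, Df) \<in> H1_unit"
  shows "pair_energy (smoothed_kernel \<sigma> \<gamma>) f = ennreal (smoothed_energy \<sigma> \<gamma> f)"
proof -
  obtain B where "\<And>x. smoothed_kernel \<sigma> \<gamma> x \<le> ennreal B"
    using smoothed_kernel_bounded[OF assms(1)] by metis
  from pair_energy_le_of_bounded[OF assms(2), of "smoothed_kernel \<sigma> \<gamma>", OF this] show ?thesis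
    unfolding smoothed_energy_def by (subst ennreal_enn2real) (auto intro: le_less_trans)
qed

lemma smoothed_energy_nonneg: "0 \<le> smoothed_energy \<sigma> \<gamma> f"
  by (simp add: smoothed_energy_def)

lemma M_crt_eq:
  fixes \<gamma> :: "'n::finite noise"
  assumes "admissible \<gamma>"
  shows "M_crt \<kappa> \<sigma> \<gamma> t p = (SUP (f, Df) \<in> H1_unit. ereal (p * t / 2 * smoothed_energy \<sigma> \<gamma> f - \<kappa> * gradient_energy Df))"
  unfolding M_crt_def
  by (intro SUP_cong) (auto simp: smoothed_energy[OF assms] smoothed_energy_nonneg)

lemma M_crt_upper:
  fixes \<gamma> :: "'n::finite noise"
  assumes "admissible \<gamma>" "(f, Df) \<in> H1_unit"
  shows "ereal (p * t / 2 * smoothed_energy \<sigma> \<gamma> f - \<kappa> * gradient_energy Df) \<le> M_crt \<kappa> \<sigma> \<gamma> t p"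
  unfolding M_crt_eq[OF assms(1)] using assms(2) by (intro SUP_upper2[of "(f, Df)"]) auto

lemma M_crt_least:
  fixes \<gamma> :: "'n::finite noise"
  assumes "admissible \<gamma>"
    and "\<And>f Df. (f, Df) \<in> H1_unit \<Longrightarrow> ereal (p * t / 2 * smoothed_energy \<sigma> \<gamma> f - \<kappa> * gradient_energy Df) \<le> m"
  shows "M_crt \<kappa> \<sigma> \<gamma> t p \<le> m"
  unfolding M_crt_eq[OF assms(1)] using assms(2) by (intro SUP_least) auto

text \<open>
  Dilating a function by \<open>c \<rightarrow> 0\<close> spreads it out and drives its gradient energy to \<open>0\<close>, while the
  interaction term is nonnegative.
\<close>
lemma M_crt_nonneg:
  fixes \<gamma> :: "'n::finite noise"
  assumes adm: "admissible \<gamma>" and "t > 0" "p > 0"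
  shows "0 \<le> M_crt \<kappa> \<sigma> \<gamma> t p"
proof -
  obtain f and Df :: "real^'n \<Rightarrow> real^'n" where H: "(f, Df) \<in> H1_unit"
    using H1_unit_nonempty by auto
  define c where "c n = inverse (real (Suc n))" for n
  have c: "c n > 0" for n by (simp add: c_def)
  have "(\<lambda>n. ereal (- (\<kappa> * ((c n)\<^sup>2 * gradient_energy Df)))) \<longlonglongrightarrow> ereal (- (\<kappa> * (0\<^sup>2 * gradient_energy Df)))"
    unfolding c_def by (intro tendsto_intros LIMSEQ_inverse_real_of_nat)
  then have lim: "(\<lambda>n. ereal (- (\<kappa> * ((c n)\<^sup>2 * gradient_energy Df)))) \<longlonglongrightarrow> 0" by (simp add: zero_ereal_def)
  show ?thesis
  proof (rule LIMSEQ_le_const2[OF lim], intro exI allI impI)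
    fix n
    have "- (\<kappa> * ((c n)\<^sup>2 * gradient_energy Df))
        \<le> p * t / 2 * smoothed_energy \<sigma> \<gamma> (dilate (c n) f) - \<kappa> * gradient_energy (dilate_gradient (c n) Df)"
      using assms H1_unit_dilate(2)[OF H c] smoothed_energy_nonneg[of \<sigma> \<gamma>] by simp
    then show "ereal (- (\<kappa> * ((c n)\<^sup>2 * gradient_energy Df))) \<le> M_crt \<kappa> \<sigma> \<gamma> t p"
      using M_crt_upper[OF adm H1_unit_dilate(1)[OF H c]] order_trans ereal_less_eq(3) by blast
  qed
qed

text \<open>
  As \<open>f\<^sup>2\<close> is a probability density, a bound on \<open>\<gamma>\<^sub>1\<close> also bounds the interaction term, and the
  gradient term only lowers the value.
\<close>
lemma M_crt_finite:
  fixes \<gamma> :: "'n::finite noise"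
  assumes adm: "admissible \<gamma>" and pos: "t > 0" "p > 0" "\<kappa> > 0"
  shows "\<bar>M_crt \<kappa> \<sigma> \<gamma> t p\<bar> \<noteq> \<infinity>"
proof -
  obtain B where B: "B \<ge> 0" "\<And>x. smoothed_kernel \<sigma> \<gamma> x \<le> ennreal B"
    using smoothed_kernel_bounded[OF adm] by metis
  have "M_crt \<kappa> \<sigma> \<gamma> t p \<le> ereal (p * t / 2 * B)"
  proof (rule M_crt_least[OF adm])
    fix f and Df :: "real^'n \<Rightarrow> real^'n" assume H: "(f, Df) \<in> H1_unit"
    have "smoothed_energy \<sigma> \<gamma> f \<le> B"
      using pair_energy_le_of_bounded[OF H, of "smoothed_kernel \<sigma> \<gamma>", OF B(2)] B(1) unfolding smoothed_energy[OF adm H] by simp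
    then have "p * t / 2 * smoothed_energy \<sigma> \<gamma> f \<le> p * t / 2 * B"
      using pos by (intro mult_left_mono) auto
    moreover have "0 \<le> \<kappa> * gradient_energy Df" using pos gradient_energy_nonneg[of Df] by simp
    ultimately show "ereal (p * t / 2 * smoothed_energy \<sigma> \<gamma> f - \<kappa> * gradient_energy Df) \<le> ereal (p * t / 2 * B)"
      by simp
  qed
  then show ?thesis using M_crt_nonneg[OF adm pos(1,2), of \<kappa> \<sigma>] by auto
qed

lemma G_const_nonneg: "0 \<le> G_const \<sigma> \<gamma>"
  unfolding G_const_def by (intro Inf_greatest) auto

text \<open>
  The case \<open>G = \<infinity>\<close> makes the threshold \<open>0\<close>, and \<open>G = 0\<close> makes it \<open>\<infinity>\<close>; the equivalences hold for
  both.
\<close>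
lemma threshold_iff:
  fixes G :: ereal
  assumes "0 \<le> G" "\<kappa> > 0" "t > 0" "p > 0"
  shows "ereal p < ereal (2 * \<kappa>) / (ereal t * G) \<longleftrightarrow> G < ereal (2 * \<kappa> / (p * t))"
    and "ereal p > ereal (2 * \<kappa>) / (ereal t * G) \<longleftrightarrow> G > ereal (2 * \<kappa> / (p * t))"
proof -
  consider "G = 0" | "G = \<infinity>" | g where "G = ereal g" "g > 0"
    using assms(1) by (cases G) (auto simp: less_le zero_ereal_def)
  then have "(ereal p < ereal (2 * \<kappa>) / (ereal t * G) \<longleftrightarrow> G < ereal (2 * \<kappa> / (p * t))) \<and>
    (ereal p > ereal (2 * \<kappa>) / (ereal t * G) \<longleftrightarrow> G > ereal (2 * \<kappa> / (p * t)))"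
    using assms by cases (auto simp: divide_ereal_def field_simps)
  then show "ereal p < ereal (2 * \<kappa>) / (ereal t * G) \<longleftrightarrow> G < ereal (2 * \<kappa> / (p * t))"
    and "ereal p > ereal (2 * \<kappa>) / (ereal t * G) \<longleftrightarrow> G > ereal (2 * \<kappa> / (p * t))" by auto
qed

text \<open>
  Below the threshold some admissible constant \<open>C\<close> has \<open>p t C / 2 \<le> \<kappa>\<close>, so smoothing being
  energy-decreasing makes the functional nonpositive.
\<close>
lemma M_crt_eq_0:
  fixes \<gamma> :: "'n::finite noise"
  assumes adm: "admissible \<gamma>" and pos: "t > 0" "p > 0" "\<kappa> > 0"
    and G: "G_const \<sigma> \<gamma> < ereal (2 * \<kappa> / (p * t))"
  shows "M_crt \<kappa> \<sigma> \<gamma> t p = 0"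
proof (rule antisym)
  obtain C where C: "C > 0" "C < 2 * \<kappa> / (p * t)"
    and le: "\<And>f Df. (f, Df) \<in> H1_unit \<Longrightarrow> noise_energy \<sigma> \<gamma> f \<le> ennreal (C * gradient_energy Df)"
    using G unfolding G_const_def Inf_less_iff by auto
  show "M_crt \<kappa> \<sigma> \<gamma> t p \<le> 0"
  proof (rule M_crt_least[OF adm])
    fix f and Df :: "real^'n \<Rightarrow> real^'n" assume H: "(f, Df) \<in> H1_unit"
    have D: "0 \<le> gradient_energy Df" by (rule gradient_energy_nonneg)
    have "ennreal (smoothed_energy \<sigma> \<gamma> f) \<le> ennreal (C * gradient_energy Df)"
      using smoothed_energy_le_noise_energy[OF adm, of f \<sigma>] H1_unit_measurable[OF H] le[OF H]
      unfolding smoothed_energy[OF adm H] by (auto intro: order_trans)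
    then have "smoothed_energy \<sigma> \<gamma> f \<le> C * gradient_energy Df"
      using C D by simp
    then have "p * t / 2 * smoothed_energy \<sigma> \<gamma> f \<le> p * t / 2 * (C * gradient_energy Df)"
      using pos by (intro mult_left_mono) auto
    also have "\<dots> = (p * t / 2 * C) * gradient_energy Df" by simp
    also have "\<dots> \<le> \<kappa> * gradient_energy Df"
      using C pos D by (intro mult_right_mono) (auto simp: field_simps)
    finally show "ereal (p * t / 2 * smoothed_energy \<sigma> \<gamma> f - \<kappa> * gradient_energy Df) \<le> 0"
      by simp
  qed
qed (rule M_crt_nonneg[OF adm pos(1,2)])

text \<open>
  Above the threshold the constant \<open>C = 2 \<kappa> / (p t)\<close> fails for some \<open>f\<close>.  By
  \<open>noise_energy_le_liminf\<close> the strict inequality survives smoothing at a small scale, and dilating \<open>f\<close>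
  turns that scale into the unit scale at which \<open>M_crt\<close> smooths.
\<close>
lemma M_crt_pos:
  fixes \<gamma> :: "'n::finite noise"
  assumes adm: "admissible \<gamma>" and \<gamma>: "scaling_exponent \<gamma> = 2"
    and pos: "t > 0" "p > 0" "\<kappa> > 0" and G: "ereal (2 * \<kappa> / (p * t)) < G_const \<sigma> \<gamma>"
  shows "0 < M_crt \<kappa> \<sigma> \<gamma> t p"
proof -
  define C where "C = 2 * \<kappa> / (p * t)"
  have C: "C > 0" using pos by (simp add: C_def)
  have "\<not> (\<forall>(f, Df) \<in> (H1_unit :: ((real^'n \<Rightarrow> real) \<times> _) set). noise_energy \<sigma> \<gamma> f \<le> ennreal (C * gradient_energy Df))"
  proof
    assume "\<forall>(f, Df) \<in> (H1_unit :: ((real^'n \<Rightarrow> real) \<times> _) set). noise_energy \<sigma> \<gamma> f \<le> ennreal (C * gradient_energy Df)"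
    with C have "G_const \<sigma> \<gamma> \<le> ereal C"
      unfolding G_const_def by (intro Inf_lower) auto
    with G show False by (simp add: C_def)
  qed
  then obtain f and Df :: "real^'n \<Rightarrow> real^'n" where H: "(f, Df) \<in> H1_unit"
    and less: "ennreal (C * gradient_energy Df) < noise_energy \<sigma> \<gamma> f"
    by (auto simp: not_le)
  note [measurable] = H1_unit_measurable[OF H]
  define D where "D = gradient_energy Df"
  have D: "D \<ge> 0" by (simp add: D_def gradient_energy_nonneg)
  let ?K = "\<lambda>n x. ennreal ((real (Suc n))\<^sup>2) * smoothed_kernel \<sigma> \<gamma> (real (Suc n) *\<^sub>R x)"
  have "noise_energy \<sigma> \<gamma> f \<le> liminf (\<lambda>n. pair_energy (?K n) f)"
  proof (rule noise_energy_le_liminf[OF _ \<gamma>, of f "\<lambda>n. real (Suc n)"])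
    show "(\<lambda>n. 1 / real (Suc n)) \<longlonglongrightarrow> 0"
      using LIMSEQ_inverse_real_of_nat by (simp add: inverse_eq_divide)
  qed auto
  then have "ennreal (C * D) < liminf (\<lambda>n. pair_energy (?K n) f)"
    using less by (simp add: D_def less_le_trans)
  moreover have "liminf (\<lambda>n. pair_energy (?K n) f) \<le> ennreal (C * D)"
    if "\<And>n. pair_energy (?K n) f \<le> ennreal (C * D)"
    using that by (intro Liminf_le) (auto simp del: of_nat_Suc)
  ultimately have "\<exists>n. ennreal (C * D) < pair_energy (?K n) f"
    by (meson not_le)
  then obtain n where n: "ennreal (C * D) < pair_energy (?K n) f" by blast
  define c where "c = 1 / real (Suc n)"
  have c: "c > 0" "real (Suc n) = 1 / c" by (simp_all add: c_def)
  note H' = H1_unit_dilate[OF H c(1)]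
  let ?e = "smoothed_energy \<sigma> \<gamma> (dilate c f)"
  have "pair_energy (?K n) f = ennreal ((1 / c)\<^sup>2) * pair_energy (smoothed_kernel \<sigma> \<gamma>) (dilate c f)"
    unfolding c(2) using c(1) by (subst pair_energy_cmult) (auto simp: pair_energy_dilate)
  also have "\<dots> = ennreal ((1 / c)\<^sup>2 * ?e)"
    unfolding smoothed_energy[OF adm H'(1)] by (rule ennreal_mult[symmetric]) (auto simp: smoothed_energy_nonneg)
  finally have "C * D < (1 / c)\<^sup>2 * ?e"
    using n C D by (simp add: ennreal_less_iff)
  then have "c\<^sup>2 * (C * D) < ?e"
    using c(1) by (simp add: power_divide field_simps)
  then have "p * t / 2 * (c\<^sup>2 * (C * D)) < p * t / 2 * ?e"
    using pos by (intro mult_strict_left_mono) auto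
  also have "p * t / 2 * (c\<^sup>2 * (C * D)) = \<kappa> * gradient_energy (dilate_gradient c Df)"
    unfolding H'(2) using pos by (simp add: C_def D_def field_simps)
  finally have "0 < ereal (p * t / 2 * ?e - \<kappa> * gradient_energy (dilate_gradient c Df))" by simp
  also have "\<dots> \<le> M_crt \<kappa> \<sigma> \<gamma> t p" by (rule M_crt_upper[OF adm H'(1)])
  finally show ?thesis .
qed

text \<open>
  \<open>M_crt / p\<close> is nondecreasing in \<open>p\<close>, since only the gradient term depends on \<open>p\<close> after division.
  Hence \<open>M_crt\<close> at \<open>q\<close> is at least \<open>q / p\<close> times its value at \<open>p\<close>, which is strictly larger when
  that value is positive.
\<close>
lemma M_crt_strict_mono:
  fixes \<gamma> :: "'n::finite noise"
  assumes adm: "admissible \<gamma>" and pos: "t > 0" "0 < p" "p < q" "\<kappa> > 0"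
    and M: "0 < M_crt \<kappa> \<sigma> \<gamma> t p"
  shows "M_crt \<kappa> \<sigma> \<gamma> t p < M_crt \<kappa> \<sigma> \<gamma> t q"
proof -
  obtain a b where ab: "M_crt \<kappa> \<sigma> \<gamma> t p = ereal a" "M_crt \<kappa> \<sigma> \<gamma> t q = ereal b"
    using M_crt_finite[OF adm, of t p \<kappa> \<sigma>] M_crt_finite[OF adm, of t q \<kappa> \<sigma>] pos by force
  have "M_crt \<kappa> \<sigma> \<gamma> t p \<le> ereal (p / q * b)"
  proof (rule M_crt_least[OF adm])
    fix f and Df :: "real^'n \<Rightarrow> real^'n" assume H: "(f, Df) \<in> H1_unit"
    have "p / q * (q * t / 2 * smoothed_energy \<sigma> \<gamma> f - \<kappa> * gradient_energy Df) \<le> p / q * b"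
      using M_crt_upper[OF adm H, of q t \<sigma> \<kappa>] pos unfolding ab by (intro mult_left_mono) auto
    moreover have "p / q * (\<kappa> * gradient_energy Df) \<le> \<kappa> * gradient_energy Df"
      using pos gradient_energy_nonneg[of Df] by (intro mult_left_le_one_le) auto
    moreover have "p / q * (q * t / 2 * smoothed_energy \<sigma> \<gamma> f) = p * t / 2 * smoothed_energy \<sigma> \<gamma> f"
      using pos by simp
    ultimately show "ereal (p * t / 2 * smoothed_energy \<sigma> \<gamma> f - \<kappa> * gradient_energy Df) \<le> ereal (p / q * b)"
      by (simp only: right_diff_distrib ereal_less_eq)
  qed
  then have "q * a \<le> p * b" using pos by (simp add: ab field_simps)
  moreover have "p * a < q * a" using M pos by (simp add: ab)
  ultimately have "p * a < p * b" by linarith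
  then show ?thesis using pos by (simp add: ab)
qed

theorem proposition2p18:
  fixes \<gamma> :: "'n::finite noise" and \<kappa> \<sigma> :: real
  assumes "\<kappa> > 0" and "\<sigma> > 0"
    and "admissible \<gamma>" and "scaling_exponent \<gamma> = 2"
  shows "(\<forall>t>0. \<forall>p>0. \<bar>M_crt \<kappa> \<sigma> \<gamma> t p\<bar> \<noteq> \<infinity>) \<and>
    (\<forall>t>0. \<forall>p>0.
       (ereal p < ereal (2 * \<kappa>) / (ereal t * G_const \<sigma> \<gamma>) \<longleftrightarrow>
        ereal t < ereal (2 * \<kappa>) / (ereal p * G_const \<sigma> \<gamma>)) \<and>
       (ereal p > ereal (2 * \<kappa>) / (ereal t * G_const \<sigma> \<gamma>) \<longleftrightarrow>
        ereal t > ereal (2 * \<kappa>) / (ereal p * G_const \<sigma> \<gamma>))) \<and>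
    (\<forall>t>0. \<forall>p>0. ereal p < ereal (2 * \<kappa>) / (ereal t * G_const \<sigma> \<gamma>) \<longrightarrow>
       M_crt \<kappa> \<sigma> \<gamma> t p = 0) \<and>
    (\<forall>t>0. \<forall>p>0. ereal p > ereal (2 * \<kappa>) / (ereal t * G_const \<sigma> \<gamma>) \<longrightarrow>
       M_crt \<kappa> \<sigma> \<gamma> t p > 0) \<and>
    (\<forall>t>0. strict_mono_on {p. p > 0 \<and> ereal p > ereal (2 * \<kappa>) / (ereal t * G_const \<sigma> \<gamma>)}
       (\<lambda>p. M_crt \<kappa> \<sigma> \<gamma> t p))"
proof -
  note adm = \<open>admissible \<gamma>\<close> and \<gamma> = \<open>scaling_exponent \<gamma> = 2\<close> and \<kappa> = \<open>\<kappa> > 0\<close>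
  note iff = threshold_iff[OF G_const_nonneg \<kappa>, of _ _ \<sigma> \<gamma>]
  have super: "0 < M_crt \<kappa> \<sigma> \<gamma> t p"
    if "t > 0" "p > 0" "ereal p > ereal (2 * \<kappa>) / (ereal t * G_const \<sigma> \<gamma>)" for t p
    using M_crt_pos[OF adm \<gamma> that(1,2) \<kappa>] that(3) unfolding iff(2)[OF that(1,2)] .
  show ?thesis
  proof (intro conjI allI impI)
    fix t p :: real assume tp: "t > 0" "p > 0"
    show "\<bar>M_crt \<kappa> \<sigma> \<gamma> t p\<bar> \<noteq> \<infinity>" by (rule M_crt_finite[OF adm tp \<kappa>])
    show "ereal p < ereal (2 * \<kappa>) / (ereal t * G_const \<sigma> \<gamma>) \<longleftrightarrow>
        ereal t < ereal (2 * \<kappa>) / (ereal p * G_const \<sigma> \<gamma>)"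
      "ereal p > ereal (2 * \<kappa>) / (ereal t * G_const \<sigma> \<gamma>) \<longleftrightarrow>
        ereal t > ereal (2 * \<kappa>) / (ereal p * G_const \<sigma> \<gamma>)"
      unfolding iff[OF tp] iff[OF tp(2,1)] by (simp_all add: mult.commute)
    show "M_crt \<kappa> \<sigma> \<gamma> t p = 0" if "ereal p < ereal (2 * \<kappa>) / (ereal t * G_const \<sigma> \<gamma>)"
      using M_crt_eq_0[OF adm tp \<kappa>] that unfolding iff(1)[OF tp] .
    show "M_crt \<kappa> \<sigma> \<gamma> t p > 0" if "ereal p > ereal (2 * \<kappa>) / (ereal t * G_const \<sigma> \<gamma>)"
      by (rule super[OF tp that])
  next
    fix t :: real assume "t > 0"
    then show "strict_mono_on {p. p > 0 \<and> ereal p > ereal (2 * \<kappa>) / (ereal t * G_const \<sigma> \<gamma>)}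
       (\<lambda>p. M_crt \<kappa> \<sigma> \<gamma> t p)"
      by (intro strict_mono_onI M_crt_strict_mono[OF adm _ _ _ \<kappa>] super) auto
  qed
qed

end
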